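(* Let $G$ be a totally disconnected, locally compact group that is hyperbolic. Then the flat-rank of $G$ is at most $1$.
   Context: A topological group is called hyperbolic if it is compactly generated and its Cayley graph with respect to some (equivalently, any) compact generating set is Gromov-hyperbolic. Let $G$ be a totally disconnected, locally compact group. The scale of an automorphism $\alpha$ of the topological group $G$ is the positive integer $s_G(\alpha)=\min\{|\alpha(O):\alpha(O)\cap O| : O\leqslant G \text{ compact and open}\}$. A compact open subgroup $O$ is minimizing for $\alpha$ if this minimum is attained at $O$. A group $\mathcal{A}$ of automorphisms of $G$ is flat if there is a compact open subgroup $O\leqslant G$ that is minimizing for every $\alpha\in\mathcal{A}$. In that case put $\mathcal{A}_1=\{\alpha\in\mathcal{A}:\alpha(O)=O\}$; it is known that $\mathcal{A}_1$ is a normal subgroup of $\mathcal{A}$, independent of the choice of minimizing subgroup $O$, and that $\mathcal{A}/\mathcal{A}_1$ is free abelian. The rank of the flat group $\mathcal{A}$ is the rank of $\mathcal{A}/\mathcal{A}_1$. The flat-rank of a group $\mathcal{A}$ of automorphisms of $G$ is the supremum of the ranks of all flat subgroups of $\mathcal{A}$. The flat-rank of $G$ is the flat-rank of its group of inner automorphisms. *)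

theory Defs
  imports
    "HOL-Analysis.Analysis"
    "HOL-Algebra.Free_Abelian_Groups"
    "HOL-Algebra.Bij"
    "HOL-Library.Extended_Nat"
begin

section \<open>Topological groups\<close>

locale topological_group = group G
  for G :: "('a, 'b) monoid_scheme" (structure) and T :: "'a topology" +
  assumes topspace_carrier: "topspace T = carrier G"
    and continuous_mult: "continuous_map (prod_topology T T) T (\<lambda>(x, y). x \<otimes> y)"
    and continuous_inv: "continuous_map T T (\<lambda>x. inv x)"

definition totally_disconnected_space :: "'a topology \<Rightarrow> bool" where
  "totally_disconnected_space T \<longleftrightarrow>
     (\<forall>S. connectedin T S \<longrightarrow> (\<forall>x\<in>S. \<forall>y\<in>S. x = y))"

text \<open>The Hausdorff property is not assumed: a totally disconnected topological group has closed
  points, hence is Hausdorff.\<close>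

definition tdlc_group :: "('a, 'b) monoid_scheme \<Rightarrow> 'a topology \<Rightarrow> bool" where
  "tdlc_group G T \<longleftrightarrow>
     topological_group G T \<and> locally_compact_space T \<and> totally_disconnected_space T"


section \<open>Hyperbolic topological groups\<close>

definition compact_generating_set ::
    "('a, 'b) monoid_scheme \<Rightarrow> 'a topology \<Rightarrow> 'a set \<Rightarrow> bool" where
  "compact_generating_set G T K \<longleftrightarrow> compactin T K \<and> generate G K = carrier G"

text \<open>The Cayley graph is the undirected graph on the carrier in which \<open>g\<close> is joined to \<open>g s\<close>
  for each generator \<open>s\<close>. It is given by its symmetric adjacency relation.\<close>

definition cayley_graph :: "('a, 'b) monoid_scheme \<Rightarrow> 'a set \<Rightarrow> ('a \<times> 'a) set" where
  "cayley_graph G K =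
     {(x, y). x \<in> carrier G \<and> y \<in> carrier G \<and>
        (\<exists>s\<in>K. y = x \<otimes>\<^bsub>G\<^esub> s \<or> x = y \<otimes>\<^bsub>G\<^esub> s)}"

text \<open>Path metric on the vertices of a graph. The value is meaningful only when some path
  joins the two vertices; see \<open>Metric_space_cayley_graph\<close> below.\<close>

definition graph_dist :: "('v \<times> 'v) set \<Rightarrow> 'v \<Rightarrow> 'v \<Rightarrow> real" where
  "graph_dist E x y = real (LEAST n. (x, y) \<in> E ^^ n)"

definition gromov_product :: "('m \<Rightarrow> 'm \<Rightarrow> real) \<Rightarrow> 'm \<Rightarrow> 'm \<Rightarrow> 'm \<Rightarrow> real" where
  "gromov_product d w x y = (d x w + d y w - d x y) / 2"

definition gromov_hyperbolic :: "'m set \<Rightarrow> ('m \<Rightarrow> 'm \<Rightarrow> real) \<Rightarrow> bool" where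
  "gromov_hyperbolic M d \<longleftrightarrow> Metric_space M d \<and>
     (\<exists>\<delta>\<ge>0. \<forall>w\<in>M. \<forall>x\<in>M. \<forall>y\<in>M. \<forall>z\<in>M.
        gromov_product d w x z
          \<ge> min (gromov_product d w x y) (gromov_product d w y z) - \<delta>)"

definition hyperbolic_group :: "('a, 'b) monoid_scheme \<Rightarrow> 'a topology \<Rightarrow> bool" where
  "hyperbolic_group G T \<longleftrightarrow> topological_group G T \<and>
     (\<exists>K. compact_generating_set G T K \<and>
          gromov_hyperbolic (carrier G) (graph_dist (cayley_graph G K)))"

lemma relpow_sym:
  assumes "sym E" "(x, y) \<in> E ^^ n"
  shows "(y, x) \<in> E ^^ n"
  using assms(2)
proof (induction n arbitrary: y)
  case (Suc n)
  then obtain z where "(x, z) \<in> E ^^ n" "(z, y) \<in> E"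
    by auto
  then show ?case
    using Suc.IH assms(1) by (meson relpow_Suc_I2 symD)
qed auto

lemma (in group) cayley_graph_connected:
  assumes K: "generate G K = carrier G" and x: "x \<in> carrier G" and y: "y \<in> carrier G"
  shows "(x, y) \<in> (cayley_graph G K)\<^sup>*"
proof -
  have KG: "K \<subseteq> carrier G"
    using K generate.incl[of _ K G] by blast
  have step: "(u, u \<otimes> h) \<in> (cayley_graph G K)\<^sup>*"
    if "h \<in> generate G K" "u \<in> carrier G" for h u
    using that
  proof (induction h arbitrary: u rule: generate.induct)
    case (incl h)
    then show ?case
      using KG by (intro r_into_rtrancl) (auto simp: cayley_graph_def)
  next
    case (inv h)
    then have "u = u \<otimes> inv h \<otimes> h"
      using KG by (simp add: inv_solve_right' m_assoc subset_iff)
    with inv KG show ?case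
      by (intro r_into_rtrancl) (auto simp: cayley_graph_def)
  next
    case (eng h1 h2)
    then have h: "h1 \<in> carrier G" "h2 \<in> carrier G"
      using K by auto
    then have "(u \<otimes> h1, u \<otimes> h1 \<otimes> h2) \<in> (cayley_graph G K)\<^sup>*"
      using eng by auto
    with eng h show ?case
      by (metis m_assoc rtrancl_trans)
  qed auto
  have "inv x \<otimes> y \<in> generate G K"
    using K x y by auto
  from step[OF this x] show ?thesis
    using x y by (simp add: inv_solve_left' flip: m_assoc)
qed

text \<open>Hence the requirement \<open>Metric_space\<close> in \<open>gromov_hyperbolic\<close> is automatic for the
  Cayley graph with respect to a generating set.\<close>

lemma (in group) Metric_space_cayley_graph:
  assumes K: "generate G K = carrier G"
  shows "Metric_space (carrier G) (graph_dist (cayley_graph G K))"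
proof
  let ?E = "cayley_graph G K"
  have sym: "sym ?E"
    by (auto simp: sym_def cayley_graph_def)
  have path: "(x, y) \<in> ?E ^^ (LEAST n. (x, y) \<in> ?E ^^ n)"
    if "x \<in> carrier G" "y \<in> carrier G" for x y
  proof -
    have "\<exists>n. (x, y) \<in> ?E ^^ n"
      using cayley_graph_connected[OF K that] by (simp add: rtrancl_power)
    then show ?thesis by (rule LeastI_ex)
  qed
  show "0 \<le> graph_dist ?E x y" for x y
    by (simp add: graph_dist_def)
  show "graph_dist ?E x y = graph_dist ?E y x" for x y
    unfolding graph_dist_def using relpow_sym[OF sym] by metis
  show "graph_dist ?E x y = 0 \<longleftrightarrow> x = y" if "x \<in> carrier G" "y \<in> carrier G" for x y
    using path[OF that] by (auto simp: graph_dist_def)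
  show "graph_dist ?E x z \<le> graph_dist ?E x y + graph_dist ?E y z"
    if "x \<in> carrier G" "y \<in> carrier G" "z \<in> carrier G" for x y z
  proof -
    have "(x, z) \<in> ?E ^^ ((LEAST n. (x, y) \<in> ?E ^^ n) + (LEAST n. (y, z) \<in> ?E ^^ n))"
      unfolding relpow_add using path that by blast
    from Least_le[of "\<lambda>n. (x, z) \<in> ?E ^^ n", OF this] show ?thesis
      by (simp add: graph_dist_def)
  qed
qed


section \<open>Automorphisms and the scale\<close>

definition compact_open_subgroup ::
    "('a, 'b) monoid_scheme \<Rightarrow> 'a topology \<Rightarrow> 'a set \<Rightarrow> bool" where
  "compact_open_subgroup G T U \<longleftrightarrow> subgroup U G \<and> compactin T U \<and> openin T U"

text \<open>As in \<open>AutoGroup\<close>, automorphisms are extensional functions on the carrier and the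
  multiplication is composition.\<close>

definition top_auto :: "('a, 'b) monoid_scheme \<Rightarrow> 'a topology \<Rightarrow> ('a \<Rightarrow> 'a) set" where
  "top_auto G T = {\<alpha> \<in> auto G. homeomorphic_map T T \<alpha>}"

definition TopAutoGroup :: "('a, 'b) monoid_scheme \<Rightarrow> 'a topology \<Rightarrow> ('a \<Rightarrow> 'a) monoid" where
  "TopAutoGroup G T = AutoGroup G \<lparr>carrier := top_auto G T\<rparr>"

definition inner_auto :: "('a, 'b) monoid_scheme \<Rightarrow> ('a \<Rightarrow> 'a) set" where
  "inner_auto G = {(\<lambda>x\<in>carrier G. g \<otimes>\<^bsub>G\<^esub> x \<otimes>\<^bsub>G\<^esub> inv\<^bsub>G\<^esub> g) | g. g \<in> carrier G}"

definition subgroup_index :: "('a, 'b) monoid_scheme \<Rightarrow> 'a set \<Rightarrow> 'a set \<Rightarrow> nat" where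
  "subgroup_index G H K = card (rcosets\<^bsub>G\<lparr>carrier := H\<rparr>\<^esub> K)"

definition displacement_index ::
    "('a, 'b) monoid_scheme \<Rightarrow> ('a \<Rightarrow> 'a) \<Rightarrow> 'a set \<Rightarrow> nat" where
  "displacement_index G \<alpha> U = subgroup_index G (\<alpha> ` U) (\<alpha> ` U \<inter> U)"

text \<open>For compact open \<open>U\<close> and a topological automorphism \<open>\<alpha>\<close> the index is finite, so \<open>card\<close> is
  the true index; compact open subgroups exist in every totally disconnected, locally compact
  group, so the infimum over the naturals is attained.\<close>

definition scale :: "('a, 'b) monoid_scheme \<Rightarrow> 'a topology \<Rightarrow> ('a \<Rightarrow> 'a) \<Rightarrow> nat" where
  "scale G T \<alpha> = (INF U \<in> {U. compact_open_subgroup G T U}. displacement_index G \<alpha> U)"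

definition minimizing ::
    "('a, 'b) monoid_scheme \<Rightarrow> 'a topology \<Rightarrow> ('a \<Rightarrow> 'a) \<Rightarrow> 'a set \<Rightarrow> bool" where
  "minimizing G T \<alpha> U \<longleftrightarrow>
     compact_open_subgroup G T U \<and> displacement_index G \<alpha> U = scale G T \<alpha>"


section \<open>Flat groups and flat-rank\<close>

definition minimizing_for_all ::
    "('a, 'b) monoid_scheme \<Rightarrow> 'a topology \<Rightarrow> ('a \<Rightarrow> 'a) set \<Rightarrow> 'a set \<Rightarrow> bool" where
  "minimizing_for_all G T A U \<longleftrightarrow>
     compact_open_subgroup G T U \<and> (\<forall>\<alpha>\<in>A. minimizing G T \<alpha> U)"

definition flat ::
    "('a, 'b) monoid_scheme \<Rightarrow> 'a topology \<Rightarrow> ('a \<Rightarrow> 'a) set \<Rightarrow> bool" where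
  "flat G T A \<longleftrightarrow> subgroup A (TopAutoGroup G T) \<and> (\<exists>U. minimizing_for_all G T A U)"

definition set_stabilizer :: "('a \<Rightarrow> 'a) set \<Rightarrow> 'a set \<Rightarrow> ('a \<Rightarrow> 'a) set" where
  "set_stabilizer A U = {\<alpha> \<in> A. \<alpha> ` U = U}"

text \<open>\<open>Q\<close> is free abelian with a basis of cardinality \<open>r\<close>, all infinite cardinalities being
  identified with \<open>\<infinity>\<close>. Since a basis consists of elements of \<open>Q\<close>, it suffices to consider
  index sets \<open>B\<close> of the element type.\<close>

definition free_abelian_of_rank :: "('q, 'c) monoid_scheme \<Rightarrow> enat \<Rightarrow> bool" where
  "free_abelian_of_rank Q r \<longleftrightarrow>
     (\<exists>B \<subseteq> carrier Q. Q \<cong> free_Abelian_group B \<and>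
        r = (if finite B then enat (card B) else \<infinity>))"

text \<open>The rank of a flat group as a relation: the quotient is free abelian and does not depend on
  the minimizing subgroup \<open>U\<close>, so every flat group has exactly one rank.\<close>

definition flat_group_has_rank ::
    "('a, 'b) monoid_scheme \<Rightarrow> 'a topology \<Rightarrow> ('a \<Rightarrow> 'a) set \<Rightarrow> enat \<Rightarrow> bool" where
  "flat_group_has_rank G T A r \<longleftrightarrow> flat G T A \<and>
     (\<exists>U. minimizing_for_all G T A U \<and>
          free_abelian_of_rank
            ((TopAutoGroup G T)\<lparr>carrier := A\<rparr> Mod set_stabilizer A U) r)"

definition flat_rank_auto ::
    "('a, 'b) monoid_scheme \<Rightarrow> 'a topology \<Rightarrow> ('a \<Rightarrow> 'a) set \<Rightarrow> enat" where
  "flat_rank_auto G T A =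
     Sup {r. \<exists>H. subgroup H ((TopAutoGroup G T)\<lparr>carrier := A\<rparr>) \<and> flat_group_has_rank G T H r}"

definition flat_rank :: "('a, 'b) monoid_scheme \<Rightarrow> 'a topology \<Rightarrow> enat" where
  "flat_rank G T = flat_rank_auto G T (inner_auto G)"

end

theory Submission
  imports Defs
begin

text \<open>Let \<open>U\<close> be minimizing for a flat group of inner automorphisms whose quotient by the stabilizer of
  \<open>U\<close> contains \<open>\<int>\<^sup>2\<close>, and let \<open>a\<close>, \<open>b\<close> represent a basis of \<open>\<int>\<^sup>2\<close>. By minimality, no element that is
  nontrivial in the quotient normalises a compact open subgroup. This forces powers of \<open>a\<close> and \<open>b\<close> to
  be loxodromic: for an element without loxodromic powers, the first \<open>n\<close> powers all move some common
  point by a bounded amount, and by the pigeonhole principle one of them lies in a conjugate of \<open>U\<close>.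

  If \<open>a\<^sup>k U a\<^sup>-\<^sup>k\<close> stayed in a compact set for all \<open>k\<close>, then Schlichting's theorem would give a compact open
  subgroup normalised by \<open>a\<close>. So, after replacing \<open>a\<close> by its inverse if necessary, \<open>a\<^sup>k U a\<^sup>-\<^sup>k\<close> leaves every
  ball as \<open>k\<close> grows. Since \<open>b a\<^sup>k\<close> and \<open>a\<^sup>k b\<close> conjugate \<open>U\<close> to the same group, which moves both points
  only boundedly, the Gromov product of \<open>b a\<^sup>k\<close> and \<open>a\<^sup>k\<close> tends to infinity: \<open>b\<close> fixes the attracting
  end of \<open>a\<close>. Hence \<open>a\<close> and \<open>b\<close> share an end, so each \<open>a\<^sup>m\<close> is at bounded distance from some \<open>b\<^sup>n\<close>. As a
  ball meets only finitely many cosets of \<open>U\<close>, this makes some nontrivial \<open>a\<^sup>i b\<^sup>j\<close> trivial in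
  the quotient.\<close>

section \<open>Hyperbolic length functions\<close>

lemma (in group) inv_mult_cancel [simp]:
  assumes "x \<in> carrier G" "y \<in> carrier G"
  shows "inv x \<otimes> (x \<otimes> y) = y" "x \<otimes> (inv x \<otimes> y) = y"
  using assms by (simp_all flip: m_assoc)

text \<open>The intended instance is the word length of a Cayley graph. \<open>len_split\<close>
  provides a point at each integer distance along a geodesic from \<open>\<one>\<close> to
  \<open>x\<close>; \<open>four_point_len\<close> is hyperbolicity of the left-invariant metric
  \<open>ldist\<close> in four-point form.\<close>

locale hyperbolic_length = group G
  for G :: "('a, 'b) monoid_scheme" (structure) +
  fixes len :: "'a \<Rightarrow> real" and D :: real
  assumes len_one: "len \<one> = 0"
    and len_nonneg: "x \<in> carrier G \<Longrightarrow> 0 \<le> len x"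
    and len_inv: "x \<in> carrier G \<Longrightarrow> len (inv x) = len x"
    and len_mult: "\<lbrakk>x \<in> carrier G; y \<in> carrier G\<rbrakk> \<Longrightarrow> len (x \<otimes> y) \<le> len x + len y"
    and len_split: "\<lbrakk>x \<in> carrier G; real n \<le> len x\<rbrakk> \<Longrightarrow>
          \<exists>y\<in>carrier G. len y = real n \<and> len (inv y \<otimes> x) = len x - real n"
    and four_point_len: "\<lbrakk>x \<in> carrier G; y \<in> carrier G; z \<in> carrier G; w \<in> carrier G\<rbrakk> \<Longrightarrow>
          len (inv x \<otimes> z) + len (inv y \<otimes> w)
            \<le> max (len (inv x \<otimes> y) + len (inv z \<otimes> w)) (len (inv y \<otimes> z) + len (inv x \<otimes> w)) + D"
begin

definition ldist :: "'a \<Rightarrow> 'a \<Rightarrow> real" where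
  "ldist x y = len (inv x \<otimes> y)"

text \<open>The Gromov product at \<open>\<one>\<close> without the factor 1/2.\<close>

definition gromov2 :: "'a \<Rightarrow> 'a \<Rightarrow> real" where
  "gromov2 x y = len x + len y - ldist x y"

text \<open>The constant makes \<open>len (c [^] n)\<close> grow by at least \<open>D + 1\<close> in each step.\<close>

definition loxodromic :: "'a \<Rightarrow> bool" where
  "loxodromic c \<longleftrightarrow> c \<in> carrier G \<and> len c + 2 * D + 1 \<le> len (c [^] (2::nat))"

lemma four_point:
  assumes "x \<in> carrier G" "y \<in> carrier G" "z \<in> carrier G" "w \<in> carrier G"
  shows "ldist x z + ldist y w \<le> max (ldist x y + ldist z w) (ldist y z + ldist x w) + D"
  using four_point_len[OF assms] by (simp add: ldist_def)

lemma ldist_one [simp]: "x \<in> carrier G \<Longrightarrow> ldist \<one> x = len x" "x \<in> carrier G \<Longrightarrow> ldist x \<one> = len x"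
  by (auto simp: ldist_def len_inv)

lemma ldist_sym: "x \<in> carrier G \<Longrightarrow> y \<in> carrier G \<Longrightarrow> ldist x y = ldist y x"
  unfolding ldist_def using len_inv[of "inv x \<otimes> y"] by (simp add: inv_mult_group)

lemma ldist_mult_left:
  assumes "g \<in> carrier G" "x \<in> carrier G" "y \<in> carrier G"
  shows "ldist (g \<otimes> x) (g \<otimes> y) = ldist x y"
proof -
  have "inv (g \<otimes> x) \<otimes> (g \<otimes> y) = inv x \<otimes> y"
    using assms by (simp add: inv_mult_group m_assoc)
  then show ?thesis using assms by (simp add: ldist_def)
qed

lemma ldist_triangle:
  assumes "x \<in> carrier G" "y \<in> carrier G" "z \<in> carrier G"
  shows "ldist x z \<le> ldist x y + ldist y z"
proof -
  have "inv x \<otimes> z = (inv x \<otimes> y) \<otimes> (inv y \<otimes> z)"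
    using assms by (simp add: m_assoc)
  then show ?thesis using assms by (simp add: ldist_def len_mult)
qed

lemma ldist_conj:
  "\<lbrakk>x \<in> carrier G; u \<in> carrier G\<rbrakk> \<Longrightarrow> ldist x (u \<otimes> x) = len (inv x \<otimes> u \<otimes> x)"
  by (simp add: ldist_def m_assoc)

lemma ldist_mult_right: "x \<in> carrier G \<Longrightarrow> y \<in> carrier G \<Longrightarrow> ldist x (x \<otimes> y) = len y"
  by (simp add: ldist_def flip: m_assoc)

lemma D_nonneg: "0 \<le> D"
  using four_point[of \<one> \<one> \<one> \<one>] by (simp add: len_one)

lemma ldist_pow:
  assumes "a \<in> carrier G" "i \<le> j"
  shows "ldist (a [^] (i::nat)) (a [^] (j::nat)) = len (a [^] (j - i))"
proof -
  have "a [^] j = a [^] i \<otimes> a [^] (j - i)"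
    using assms by (simp add: nat_pow_mult)
  then show ?thesis
    using assms by (simp add: ldist_mult_right)
qed

text \<open>This is the four-point condition with \<open>\<one>\<close> as fourth point.\<close>

lemma gromov2_ultrametric:
  assumes "x \<in> carrier G" "y \<in> carrier G" "z \<in> carrier G"
  shows "gromov2 x z \<ge> min (gromov2 x y) (gromov2 y z) - D"
  using four_point[of x y z \<one>] assms by (simp add: gromov2_def max_def min_def split: if_splits)

text \<open>Displacement is quasi-convex. In the four-point condition for \<open>p\<close>,
  \<open>z\<close>, \<open>q\<close> and \<open>u \<otimes> z\<close>, the distances from
  \<open>p\<close> and \<open>q\<close> to \<open>u \<otimes> z\<close> exceed those to
  \<open>z\<close> by at most \<open>R\<close>. As \<open>z\<close> lies on a geodesic from
  \<open>p\<close> to \<open>q\<close> up to an excess \<open>M\<close>, this leaves little room for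
  \<open>ldist z (u \<otimes> z)\<close>.\<close>

lemma moved_between:
  assumes "p \<in> carrier G" "q \<in> carrier G" "z \<in> carrier G" "u \<in> carrier G"
    and "ldist p (u \<otimes> p) \<le> R" "ldist q (u \<otimes> q) \<le> R" "ldist p z + ldist z q \<le> ldist p q + M"
  shows "ldist z (u \<otimes> z) \<le> R + M + D"
proof -
  have "ldist p (u \<otimes> z) \<le> ldist p (u \<otimes> p) + ldist p z" "ldist q (u \<otimes> z) \<le> ldist q (u \<otimes> q) + ldist q z"
    using ldist_triangle[of p "u \<otimes> p" "u \<otimes> z"] ldist_triangle[of q "u \<otimes> q" "u \<otimes> z"] assms(1-4)
    by (auto simp: ldist_mult_left)
  moreover have "ldist p q + ldist z (u \<otimes> z)
      \<le> max (ldist p z + ldist q (u \<otimes> z)) (ldist z q + ldist p (u \<otimes> z)) + D"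
    using four_point[of p z q "u \<otimes> z"] assms by simp
  ultimately show ?thesis
    using assms ldist_sym[of z q] by (auto simp: max_def split: if_splits)
qed

section \<open>Growth of the powers of a loxodromic element\<close>

text \<open>Apply the four-point condition to \<open>\<one>\<close> and the powers with exponents
  \<open>n\<close>, \<open>n + 1\<close>, \<open>n + 2\<close>. The induction hypothesis and the
  lower bound on \<open>len (c [^] 2)\<close> rule out the first entry of the maximum, and the
  second one gives the next step.\<close>

lemma loxodromic_step:
  assumes "loxodromic c"
  shows "len (c [^] (n::nat)) + D + 1 \<le> len (c [^] Suc n)"
proof (induction n)
  case 0
  have "len (c [^] (2::nat)) \<le> len c + len c"
    using assms len_mult[of c c] by (auto simp: loxodromic_def numeral_2_eq_2)
  then show ?case
    using assms D_nonneg by (auto simp: loxodromic_def len_one)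
next
  case (Suc n)
  have c: "c \<in> carrier G" and c2: "len c + 2 * D + 1 \<le> len (c [^] (2::nat))"
    using assms by (auto simp: loxodromic_def)
  have "len (c [^] Suc n) + len (c [^] (2::nat))
      \<le> max (len (c [^] n) + len c) (len c + len (c [^] Suc (Suc n))) + D"
    using four_point[of "c [^] (0::nat)" "c [^] n" "c [^] Suc n" "c [^] Suc (Suc n)"] c
    by (simp only: ldist_pow nat_pow_closed) (simp del: nat_pow_Suc add: numeral_2_eq_2 Suc_diff_le)
  then show ?case
    using Suc c2 D_nonneg by (auto simp: max_def simp del: nat_pow_Suc split: if_splits)
qed

lemma loxodromic_growth:
  assumes "loxodromic c"
  shows "real n \<le> len (c [^] (n::nat))"
proof (induction n)
  case (Suc n)
  then show ?case
    using loxodromic_step[OF assms, of n] D_nonneg by simp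
qed (simp add: len_one)

lemma loxodromic_unbounded:
  assumes "loxodromic c"
  shows "\<exists>n. R < len (c [^] (n::nat))"
  using loxodromic_growth[OF assms] reals_Archimedean2[of R] by (meson less_le_trans)

text \<open>The powers of \<open>c\<close> run along a geodesic up to an error independent of the
  exponents. In the four-point condition for exponents \<open>0\<close>, \<open>i + k\<close>,
  \<open>i + 1\<close>, \<open>i\<close>, the growth in each step excludes the second entry of the
  maximum. The predecessor of \<open>k\<close> occurs there, hence the separate case
  \<open>k = 0\<close>.\<close>

lemma loxodromic_add:
  assumes "loxodromic c"
  shows "len (c [^] (i::nat)) + len (c [^] (k::nat)) \<le> len (c [^] (i + k)) + (len c + D)"
proof (cases k)
  case 0
  then show ?thesis
    using assms D_nonneg len_nonneg[of c] by (simp add: len_one loxodromic_def)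
next
  case (Suc l)
  have c: "c \<in> carrier G"
    using assms by (simp add: loxodromic_def)
  have eq: "ldist (c [^] (i + k)) (c [^] i) = len (c [^] k)"
    "ldist (c [^] (i + k)) (c [^] Suc i) = len (c [^] l)" "ldist (c [^] Suc i) (c [^] i) = len c"
    using c Suc ldist_pow[of c i "i + k"] ldist_pow[of c "Suc i" "i + k"] ldist_pow[of c i "Suc i"]
      ldist_sym[of "c [^] i" "c [^] (i + k)"] ldist_sym[of "c [^] Suc i" "c [^] (i + k)"]
      ldist_sym[of "c [^] i" "c [^] Suc i"]
    by (simp_all del: nat_pow_Suc)
  have "len (c [^] Suc i) + len (c [^] k)
      \<le> max (len (c [^] (i + k)) + len c) (len (c [^] l) + len (c [^] i)) + D"
    using four_point[of "c [^] (0::nat)" "c [^] (i + k)" "c [^] Suc i" "c [^] i"] c eq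
    by (simp del: nat_pow_Suc)
  then show ?thesis
    using loxodromic_step[OF assms, of i] loxodromic_step[OF assms, of l] Suc D_nonneg
    by (auto simp: max_def simp del: nat_pow_Suc split: if_splits)
qed

lemma loxodromic_between:
  assumes "loxodromic c" "(i::nat) \<le> k"
  shows "ldist \<one> (c [^] i) + ldist (c [^] i) (c [^] k) \<le> ldist \<one> (c [^] k) + (len c + D)"
  using loxodromic_add[OF assms(1), of i "k - i"] assms by (simp add: ldist_pow loxodromic_def)

lemma conj_pow:
  assumes "x \<in> carrier G" "a \<in> carrier G"
  shows "(inv x \<otimes> a \<otimes> x) [^] (n::nat) = inv x \<otimes> a [^] n \<otimes> x"
proof (induction n)
  case (Suc n)
  have "inv x \<otimes> a [^] n \<otimes> x \<otimes> (inv x \<otimes> a \<otimes> x) = inv x \<otimes> a [^] n \<otimes> a \<otimes> x"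
    using assms by (simp add: m_assoc)
  then show ?case
    using assms Suc by (simp add: m_assoc)
qed (use assms in simp)

lemma len_conj_le:
  assumes "x \<in> carrier G" "a \<in> carrier G"
  shows "len (inv x \<otimes> a \<otimes> x) \<le> len a + 2 * len x"
  using len_mult[of "inv x \<otimes> a" x] len_mult[of "inv x" a] assms by (simp add: len_inv)

lemma len_conj_ge:
  assumes "x \<in> carrier G" "a \<in> carrier G"
  shows "len a \<le> len (inv x \<otimes> a \<otimes> x) + 2 * len x"
proof -
  have "a = inv (inv x) \<otimes> (inv x \<otimes> a \<otimes> x) \<otimes> inv x"
    using assms by (simp add: m_assoc)
  then show ?thesis
    using len_conj_le[of "inv x" "inv x \<otimes> a \<otimes> x"] assms by (simp add: len_inv)
qed

text \<open>Conjugation by \<open>x\<close> changes the length of every power by at most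
  \<open>2 * len x\<close>, and a sufficiently high power outgrows this error.\<close>

lemma loxodromic_conj:
  assumes "x \<in> carrier G" "a \<in> carrier G" "loxodromic (inv x \<otimes> a \<otimes> x)"
  shows "\<exists>n>0. loxodromic (a [^] (n::nat))"
proof -
  let ?c = "inv x \<otimes> a \<otimes> x"
  \<comment> \<open>The summand \<open>len ?c + D\<close> pays for \<open>loxodromic_add\<close>,
    \<open>4 * len x\<close> for two comparisons of conjugates, and \<open>2 * D + 1\<close> is the
    margin in the definition of \<open>loxodromic\<close>.\<close>
  obtain n :: nat where n: "len ?c + D + 4 * len x + 2 * D + 1 < len (?c [^] n)"
    using loxodromic_unbounded[OF assms(3)] by blast
  have pos: "0 \<le> len ?c" "0 \<le> len x"
    using assms by (auto intro: len_nonneg)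
  have "n \<noteq> 0"
    using n pos D_nonneg by (auto simp: len_one intro!: Nat.gr0I)
  have "len (?c [^] n) + len (?c [^] n) \<le> len (?c [^] (n + n)) + (len ?c + D)"
    using loxodromic_add[OF assms(3)] by blast
  moreover have "len (?c [^] (n + n)) \<le> len (a [^] (n + n)) + 2 * len x"
    using assms by (simp add: conj_pow len_conj_le)
  moreover have "len (a [^] n) \<le> len (?c [^] n) + 2 * len x"
    using assms by (simp add: conj_pow len_conj_ge)
  ultimately have "len (a [^] n) + 2 * D + 1 \<le> len (a [^] (n + n))"
    using n by linarith
  then have "loxodromic (a [^] n)"
    using assms by (simp add: loxodromic_def nat_pow_pow mult_2_right)
  with \<open>n \<noteq> 0\<close> show ?thesis by blast
qed


section \<open>Elements without loxodromic powers\<close>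

text \<open>Take \<open>x\<close> in the middle of a geodesic from \<open>\<one>\<close> to a very
  remote power \<open>a [^] q\<close>. The small powers of \<open>a\<close> move both ends of it
  little, so they shift \<open>x\<close> along it, and squaring doubles the shift. A large shift
  would thus make a conjugate of \<open>a [^] i\<close> loxodromic, and with it a power of
  \<open>a\<close>.\<close>

lemma almost_fixed_point:
  assumes a: "a \<in> carrier G" and ell: "\<And>p. 0 < p \<Longrightarrow> \<not> loxodromic (a [^] (p::nat))"
    and unb: "\<And>R. \<exists>q. R < len (a [^] (q::nat))"
  shows "\<exists>x\<in>carrier G. \<forall>i\<le>(k::nat). len (inv x \<otimes> a [^] i \<otimes> x) \<le> 8 * D + 1"
proof -
  \<comment> \<open>A common bound for the displacement of \<open>\<one>\<close> and of
    \<open>y\<close>. The exponents go up to \<open>2 * k\<close> because \<open>i\<close> will be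
    compared with \<open>2 * i\<close>.\<close>
  define E where "E = (\<Sum>i\<le>2 * k. len (a [^] i))"
  have E: "len (a [^] i) \<le> E" if "i \<le> 2 * k" for i
    unfolding E_def using that a by (intro member_le_sum) (auto intro: len_nonneg)
  have E0: "0 \<le> E"
    using E[of 0] by (simp add: len_one)
  obtain q :: nat where q: "6 * E + 6 * D + 10 < len (a [^] q)"
    using unb by blast
  define y where "y = a [^] q"
  define Y where "Y = len y"
  \<comment> \<open>Half the length of the geodesic, rounded down because \<open>len_split\<close>
    works at integer distances.\<close>
  define t where "t = nat \<lfloor>Y / 2\<rfloor>"
  have Y: "6 * E + 6 * D + 10 < Y"
    using q by (simp add: Y_def y_def)
  then have t: "real t \<le> Y / 2" "Y / 2 - 1 < real t"
    using E0 D_nonneg by (auto simp: t_def) linarith+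
  have yG: "y \<in> carrier G"
    using a by (simp add: y_def)
  have "real t \<le> len y"
    using t E0 Y D_nonneg by (simp add: Y_def)
  from len_split[OF yG this] obtain x where xG: "x \<in> carrier G" and x: "len x = t"
    and "len (inv x \<otimes> y) = len y - t"
    by blast
  then have xy: "ldist x y = Y - t"
    by (simp add: ldist_def Y_def)
  \<comment> \<open>Since \<open>a [^] i \<otimes> y\<close> is \<open>a [^] (q + i)\<close>, this
    is the signed change of the distance of \<open>y\<close> from \<open>\<one>\<close> under
    \<open>a [^] i\<close>.\<close>
  define \<sigma> where "\<sigma> i = len (a [^] (q + i)) - Y" for i
  define L where "L i = ldist x (a [^] i \<otimes> x)" for i :: nat
  text \<open>Far from both ends of the geodesic from \<open>\<one>\<close> to \<open>y\<close>, the element \<open>a [^] i\<close> translates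
    coarsely by \<open>\<sigma> i\<close>.\<close>
  have shift: "\<bar>\<sigma> i\<bar> - D \<le> L i" "L i \<le> \<bar>\<sigma> i\<bar> + 2 * D" if i: "i \<le> 2 * k" for i
  proof -
    define g where "g = a [^] i"
    have gG: "g \<in> carrier G"
      using a by (simp add: g_def)
    have comm: "g \<otimes> y = y \<otimes> g" "g \<otimes> y = a [^] (q + i)"
      using a by (simp_all add: g_def y_def nat_pow_mult add.commute)
    have e: "len g \<le> E"
      using E[OF i] by (simp add: g_def)
    have 1: "ldist y (g \<otimes> y) = len g" "ldist (g \<otimes> y) y = len g"
      using gG yG by (auto simp: comm(1) ldist_mult_right ldist_sym[of "y \<otimes> g"])
    have 2: "ldist g (g \<otimes> x) = t" "ldist (g \<otimes> x) g = t"
      using gG xG x ldist_mult_right[of g x] ldist_sym[of g "g \<otimes> x"] by auto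
    have 3: "ldist (g \<otimes> x) (g \<otimes> y) = Y - t" "ldist (g \<otimes> y) (g \<otimes> x) = Y - t"
      using gG xG yG xy by (auto simp: ldist_mult_left ldist_sym[of y x])
    have 4: "ldist g (g \<otimes> y) = Y"
      using gG yG by (simp add: ldist_mult_right Y_def)
    \<comment> \<open>In \<open>S\<close> and in \<open>T\<close>, one of the three sums of opposite
      distances is far smaller than the others, because \<open>g\<close> moves \<open>\<one>\<close>
      and \<open>y\<close> by at most \<open>E\<close>. The other two sums therefore differ by at
      most \<open>D\<close>, which yields \<open>v\<close> and \<open>u\<close>: up to
      \<open>D\<close>, the point \<open>g \<otimes> x\<close> is \<open>\<sigma> i\<close> farther
      from \<open>\<one>\<close> than \<open>x\<close> and \<open>\<sigma> i\<close> closer to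
      \<open>y\<close>.\<close>
    have S: "ldist \<one> y + ldist (g \<otimes> x) (g \<otimes> y)
        \<le> max (ldist \<one> (g \<otimes> x) + ldist y (g \<otimes> y)) (ldist \<one> (g \<otimes> y) + ldist y (g \<otimes> x)) + D"
      "ldist \<one> (g \<otimes> y) + ldist y (g \<otimes> x)
        \<le> max (ldist \<one> y + ldist (g \<otimes> x) (g \<otimes> y)) (ldist \<one> (g \<otimes> x) + ldist y (g \<otimes> y)) + D"
      using four_point[of \<one> "g \<otimes> x" y "g \<otimes> y"] four_point[of \<one> y "g \<otimes> y" "g \<otimes> x"] xG yG gG
      by (auto simp: ldist_sym[of "g \<otimes> y" "g \<otimes> x"] ldist_sym[of "g \<otimes> x" y] ldist_sym[of "g \<otimes> y" y] max.commute add.commute)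
    have T: "ldist \<one> (g \<otimes> x) + ldist g (g \<otimes> y)
        \<le> max (ldist \<one> (g \<otimes> y) + ldist g (g \<otimes> x)) (ldist \<one> g + ldist (g \<otimes> x) (g \<otimes> y)) + D"
      "ldist \<one> (g \<otimes> y) + ldist g (g \<otimes> x)
        \<le> max (ldist \<one> (g \<otimes> x) + ldist g (g \<otimes> y)) (ldist \<one> g + ldist (g \<otimes> x) (g \<otimes> y)) + D"
      using four_point[of \<one> g "g \<otimes> x" "g \<otimes> y"] four_point[of \<one> g "g \<otimes> y" "g \<otimes> x"] xG yG gG
      by (auto simp: ldist_sym[of "g \<otimes> y" "g \<otimes> x"] max.commute add.commute)
    \<comment> \<open>This inequality turns the positions of \<open>x\<close> and
      \<open>g \<otimes> x\<close> relative to \<open>\<one>\<close> and \<open>y\<close> into the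
      upper bound for \<open>L i\<close>; the lower bound needs only the triangle
      inequality.\<close>
    have P: "ldist \<one> y + ldist x (g \<otimes> x)
        \<le> max (ldist \<one> x + ldist y (g \<otimes> x)) (ldist \<one> (g \<otimes> x) + ldist x y) + D"
      using four_point[of \<one> x y "g \<otimes> x"] xG yG gG by (simp add: ldist_sym[of x y] add.commute)
    have tri: "len (g \<otimes> x) \<le> len g + t" "t \<le> len (g \<otimes> x) + len g"
      "Y - len g \<le> len (g \<otimes> y)" "Y - t \<le> ldist y (g \<otimes> x) + len g"
      "t \<le> len (g \<otimes> x) + L i" "len (g \<otimes> x) \<le> t + L i"
      "Y - t \<le> ldist y (g \<otimes> x) + L i" "ldist y (g \<otimes> x) \<le> Y - t + L i"
      using ldist_triangle[of \<one> g "g \<otimes> x"] ldist_triangle[of g \<one> "g \<otimes> x"] ldist_triangle[of \<one> "g \<otimes> y" y]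
        ldist_triangle[of "g \<otimes> y" y "g \<otimes> x"] ldist_triangle[of \<one> "g \<otimes> x" x] ldist_triangle[of \<one> x "g \<otimes> x"]
        ldist_triangle[of y "g \<otimes> x" x] ldist_triangle[of y x "g \<otimes> x"]
        xG yG gG 1 2 3 4 x xy ldist_sym[of x y] ldist_sym[of "g \<otimes> x" x]
      by (auto simp: L_def Y_def g_def[symmetric])
    have v: "\<bar>len (g \<otimes> y) + ldist y (g \<otimes> x) - (2 * Y - t)\<bar> \<le> D"
      using S 1 2 3 4 tri t Y e gG xG yG E0 D_nonneg
      by (auto simp: Y_def[symmetric] max_def split: if_splits)
    have u: "\<bar>len (g \<otimes> x) + Y - (len (g \<otimes> y) + t)\<bar> \<le> D"
      using T 1 2 3 4 tri t Y e gG xG yG E0 D_nonneg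
      by (auto simp: Y_def[symmetric] max_def split: if_splits)
    have L: "L i + Y \<le> max (t + ldist y (g \<otimes> x)) (len (g \<otimes> x) + Y - t) + D"
      using P xG yG gG x xy by (simp add: L_def Y_def g_def)
    have s: "\<sigma> i = len (g \<otimes> y) - Y"
      by (simp add: \<sigma>_def comm(2))
    show "\<bar>\<sigma> i\<bar> - D \<le> L i" "L i \<le> \<bar>\<sigma> i\<bar> + 2 * D"
      using u v L s tri by (auto simp: max_def abs_if split: if_splits)
  qed
  \<comment> \<open>Again one sum, here \<open>2 * len (a [^] i)\<close>, is negligible, so
    \<open>Y + len (a [^] (q + 2 * i))\<close> and \<open>2 * len (a [^] (q + i))\<close> agree up
    to \<open>D\<close>.\<close>
  have double: "2 * \<bar>\<sigma> i\<bar> - D \<le> \<bar>\<sigma> (2 * i)\<bar>" if i: "i \<le> k" for i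
  proof -
    have "ldist (a [^] i) (a [^] (q + i)) + ldist \<one> (a [^] (q + 2 * i))
        \<le> max (ldist (a [^] i) (a [^] (q + 2 * i)) + ldist \<one> (a [^] (q + i)))
              (ldist (a [^] i) \<one> + ldist (a [^] (q + i)) (a [^] (q + 2 * i))) + D"
      "ldist (a [^] i) (a [^] (q + 2 * i)) + ldist \<one> (a [^] (q + i))
        \<le> max (ldist (a [^] i) (a [^] (q + i)) + ldist \<one> (a [^] (q + 2 * i)))
              (ldist (a [^] i) \<one> + ldist (a [^] (q + i)) (a [^] (q + 2 * i))) + D"
      using four_point[of "a [^] i" \<one> "a [^] (q + i)" "a [^] (q + 2 * i)"]
        four_point[of "a [^] i" \<one> "a [^] (q + 2 * i)" "a [^] (q + i)"] a
        ldist_sym[of "a [^] (q + 2 * i)" "a [^] (q + i)"]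
      by (simp_all add: max.commute add.commute)
    then have *: "Y + len (a [^] (q + 2 * i)) \<le> max (2 * len (a [^] (q + i))) (2 * len (a [^] i)) + D"
      "2 * len (a [^] (q + i)) \<le> max (Y + len (a [^] (q + 2 * i))) (2 * len (a [^] i)) + D"
      using a by (simp_all add: ldist_pow Y_def y_def add.commute[of i q])
    have "Y \<le> len (a [^] (q + i)) + len (a [^] i)"
      using ldist_triangle[of \<one> "a [^] (q + i)" "a [^] q"] a
      by (simp add: ldist_sym[of "a [^] (q + i)"] ldist_pow Y_def y_def)
    then show ?thesis
      using * E[of i] i Y E0 D_nonneg
      by (auto simp: \<sigma>_def max_def abs_if split: if_splits)
  qed
  have "len (inv x \<otimes> a [^] i \<otimes> x) \<le> 8 * D + 1" if i: "i \<le> k" for i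
  proof (cases "i = 0")
    case False
    let ?c = "inv x \<otimes> a [^] i \<otimes> x"
    have "\<not> loxodromic ?c"
    proof
      assume "loxodromic ?c"
      then obtain n :: nat where "n > 0" "loxodromic (a [^] (i * n))"
        using loxodromic_conj[of x "a [^] i"] a xG by (auto simp: nat_pow_pow)
      then show False
        using ell[of "i * n"] False by simp
    qed
    then have "len (?c [^] (2::nat)) < len ?c + 2 * D + 1"
      using a xG by (simp add: loxodromic_def not_le)
    moreover have "?c [^] (2::nat) = inv x \<otimes> a [^] (2 * i) \<otimes> x"
      using a xG by (simp add: conj_pow nat_pow_pow mult.commute)
    ultimately have "L (2 * i) < L i + 2 * D + 1"
      using a xG by (simp add: L_def ldist_conj)
    \<comment> \<open>By \<open>shift\<close> and \<open>double\<close>, \<open>L (2 * i)\<close> is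
      at least \<open>2 * L i - 6 * D\<close>, while it is less than
      \<open>L i + 2 * D + 1\<close>.\<close>
    then have "L i \<le> 8 * D + 1"
      using shift[of i] shift[of "2 * i"] double[of i] i by auto
    then show ?thesis
      using a xG by (simp add: L_def ldist_conj)
  qed (use xG D_nonneg in \<open>simp add: len_one\<close>)
  with xG show ?thesis by blast
qed

text \<open>If the powers of \<open>a\<close> are bounded, \<open>\<one>\<close> serves as
  \<open>x\<close>; otherwise \<open>almost_fixed_point\<close> applies. The point \<open>x\<close>
  may vary with \<open>k\<close>, but \<open>R\<close> may not, and this uniformity is what the
  later pigeonhole argument needs.\<close>

lemma no_parabolics:
  assumes a: "a \<in> carrier G" and ell: "\<And>p. 0 < p \<Longrightarrow> \<not> loxodromic (a [^] (p::nat))"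
  shows "\<exists>R. \<forall>k::nat. \<exists>x\<in>carrier G. \<forall>i\<le>k. len (inv x \<otimes> a [^] i \<otimes> x) \<le> R"
proof (cases "\<exists>R. \<forall>q::nat. len (a [^] q) \<le> R")
  case True
  then obtain R where "\<And>q::nat. len (a [^] q) \<le> R" by blast
  then show ?thesis
    using a by (intro exI[of _ R] allI bexI[of _ \<one>]) auto
next
  case False
  then show ?thesis
    using almost_fixed_point[OF assms] by (meson not_le)
qed

section \<open>Ends of loxodromic elements\<close>

text \<open>If \<open>b\<close> fixes the attracting end of \<open>a\<close>, then this end is one of the two ends of \<open>b\<close>.\<close>

lemma loxodromic_fixed_end:
  assumes a: "a \<in> carrier G" and b: "loxodromic b"
    and fix_end: "\<And>j R. \<exists>k. R \<le> gromov2 (b [^] (j::nat) \<otimes> a [^] k) (a [^] (k::nat))"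
  shows "(\<forall>M. \<exists>j k. M < gromov2 (b [^] (j::nat)) (a [^] (k::nat))) \<or>
         (\<forall>M. \<exists>j k. M < gromov2 (inv b [^] (j::nat)) (a [^] (k::nat)))"
proof (rule ccontr)
  assume "\<not> ?thesis"
  then obtain M1 M2 where M1: "\<And>j k::nat. gromov2 (b [^] (j::nat)) (a [^] k) \<le> M1"
    and M2: "\<And>j k::nat. gromov2 (inv b [^] (j::nat)) (a [^] k) \<le> M2"
    by (meson not_le)
  have bG: "b \<in> carrier G"
    using b by (simp add: loxodromic_def)
  obtain j :: nat where j: "\<bar>M1\<bar> + \<bar>M2\<bar> + D < len (b [^] j)"
    using loxodromic_unbounded[OF b] by blast
  obtain k :: nat where k: "\<bar>M1\<bar> + D + 1 \<le> gromov2 (b [^] j \<otimes> a [^] k) (a [^] k)"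
    using fix_end by blast
  have "ldist (b [^] j) (b [^] j \<otimes> a [^] k) = len (a [^] k)"
    using a bG by (simp add: ldist_mult_right)
  moreover have "ldist (inv b [^] j) (a [^] k) = len (b [^] j \<otimes> a [^] k)"
    using a bG by (simp add: ldist_def nat_pow_inv)
  moreover have "len (inv b [^] j) = len (b [^] j)"
    using bG by (simp add: nat_pow_inv len_inv)
  \<comment> \<open>Translation by \<open>b [^] j\<close> shows that this product and that of
    \<open>inv b [^] j\<close> with \<open>a [^] k\<close> add up to
    \<open>2 * len (b [^] j)\<close>. A bound on the latter makes the former large.\<close>
  ultimately have "2 * len (b [^] j) - M2 \<le> gromov2 (b [^] j) (b [^] j \<otimes> a [^] k)"
    using M2[of j k] by (simp add: gromov2_def)
  moreover have "min (gromov2 (b [^] j) (b [^] j \<otimes> a [^] k)) (gromov2 (b [^] j \<otimes> a [^] k) (a [^] k)) - D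
      \<le> gromov2 (b [^] j) (a [^] k)"
    using a bG by (intro gromov2_ultrametric) auto
  ultimately show False
    using M1[of j k] j k D_nonneg by (auto simp: min_def split: if_splits)
qed

text \<open>Compare \<open>a [^] m\<close> with the first power \<open>b [^] n\<close> that is
  longer. Both lie near geodesics to remote powers \<open>a [^] k\<close> and \<open>b [^] j\<close>
  with a large Gromov product. The ultrametric inequality, used twice along \<open>a [^] m\<close>,
  \<open>a [^] k\<close>, \<open>b [^] j\<close>, \<open>b [^] n\<close>, makes the product of
  \<open>a [^] m\<close> and \<open>b [^] n\<close> almost maximal.\<close>

lemma loxodromic_same_end:
  assumes a: "loxodromic a" and b: "loxodromic b"
    and same: "\<And>M. \<exists>j k. M < gromov2 (b [^] (j::nat)) (a [^] (k::nat))"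
  shows "\<exists>C. \<forall>m::nat. \<exists>n::nat. ldist (a [^] m) (b [^] n) \<le> C"
proof (intro exI[of _ "len a + 2 * len b + 3 * D"] allI)
  fix m :: nat
  have aG: "a \<in> carrier G" and bG: "b \<in> carrier G"
    using a b by (auto simp: loxodromic_def)
  have pos: "0 \<le> len a" "0 \<le> len b"
    using aG bG by (auto intro: len_nonneg)
  define t where "t = len (a [^] m)"
  have t0: "0 \<le> t"
    using aG by (simp add: t_def len_nonneg)
  have len_pow: "len (a [^] k) \<le> real k * len a" for k :: nat
  proof (induction k)
    case (Suc k)
    then show ?case
      using len_mult[of "a [^] k" a] aG by (simp add: algebra_simps)
  qed (simp add: len_one)
  \<comment> \<open>Included in the bound for the Gromov product to force \<open>m \<le> k\<close>:
    that product is at most \<open>2 * len (a [^] k)\<close>, and \<open>len (a [^] k)\<close> is at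
    most \<open>real k * len a\<close>.\<close>
  define P where "P = real m * len a"
  have P0: "0 \<le> P"
    using pos by (simp add: P_def)
  obtain j k :: nat where jk: "2 * (P + t + len b + D) < gromov2 (b [^] j) (a [^] k)"
    using same by blast
  have gp: "gromov2 (b [^] j) (a [^] k) \<le> 2 * len (a [^] k)" "gromov2 (b [^] j) (a [^] k) \<le> 2 * len (b [^] j)"
    using ldist_triangle[of \<one> "a [^] k" "b [^] j"] ldist_triangle[of \<one> "b [^] j" "a [^] k"] aG bG
    by (auto simp: gromov2_def ldist_sym[of "a [^] k"])
  have "P < len (a [^] k)"
    using gp jk t0 pos D_nonneg by argo
  also have "\<dots> \<le> real k * len a"
    by (rule len_pow)
  finally have "P < real k * len a" .
  then have "m \<le> k"
    using pos by (simp add: P_def mult_less_cancel_right)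
  \<comment> \<open>One more factor \<open>b\<close> adds at most \<open>len b\<close>, so the first
    power beyond \<open>t\<close> has length at most \<open>t + len b\<close>.\<close>
  define n where "n = (LEAST n. t < len (b [^] (n::nat)))"
  have tj: "t < len (b [^] j)"
    using jk gp pos D_nonneg P0 by argo
  have n: "t < len (b [^] n)"
    unfolding n_def using tj by (rule LeastI)
  have "n \<le> j"
    unfolding n_def using tj by (rule Least_le)
  have "n \<noteq> 0"
    using n t0 by (auto simp: len_one intro!: Nat.gr0I)
  then obtain n' where n': "n = Suc n'"
    using not0_implies_Suc by blast
  then have "len (b [^] n') \<le> t"
    using not_less_Least[of n' "\<lambda>n. t < len (b [^] n)"] by (simp add: n_def)
  then have nt: "len (b [^] n) \<le> t + len b"
    using n' len_mult[of "b [^] n'" b] bG by simp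
  have g1: "2 * t - (len a + D) \<le> gromov2 (a [^] m) (a [^] k)"
    using loxodromic_between[OF a \<open>m \<le> k\<close>] aG by (simp add: gromov2_def t_def)
  have g2: "2 * len (b [^] n) - (len b + D) \<le> gromov2 (b [^] j) (b [^] n)"
    using loxodromic_between[OF b \<open>n \<le> j\<close>] bG by (simp add: gromov2_def ldist_sym[of "b [^] j"])
  have "min (gromov2 (a [^] m) (a [^] k)) (gromov2 (a [^] k) (b [^] n)) - D \<le> gromov2 (a [^] m) (b [^] n)"
    "min (gromov2 (a [^] k) (b [^] j)) (gromov2 (b [^] j) (b [^] n)) - D \<le> gromov2 (a [^] k) (b [^] n)"
    using aG bG by (auto intro!: gromov2_ultrametric)
  moreover have "gromov2 (a [^] k) (b [^] j) = gromov2 (b [^] j) (a [^] k)"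
    using aG bG by (simp add: gromov2_def ldist_sym)
  ultimately have "2 * t - (len a + len b + D) - 2 * D \<le> gromov2 (a [^] m) (b [^] n)"
    using g1 g2 jk pos D_nonneg n t0 P0 by (auto simp: min_def split: if_splits)
  then show "\<exists>n::nat. ldist (a [^] m) (b [^] n) \<le> len a + 2 * len b + 3 * D"
    using nt by (intro exI[of _ n]) (simp add: gromov2_def t_def)
qed

end

section \<open>Conjugates and cosets in topological groups\<close>

definition conj_set :: "('a, 'b) monoid_scheme \<Rightarrow> 'a \<Rightarrow> 'a set \<Rightarrow> 'a set" where
  "conj_set G g X = (\<lambda>x. g \<otimes>\<^bsub>G\<^esub> x \<otimes>\<^bsub>G\<^esub> inv\<^bsub>G\<^esub> g) ` X"

context group
begin

lemma conj_set_mono: "X \<subseteq> Y \<Longrightarrow> conj_set G g X \<subseteq> conj_set G g Y"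
  by (auto simp: conj_set_def)

lemma conj_set_mult:
  assumes "g \<in> carrier G" "h \<in> carrier G" "X \<subseteq> carrier G"
  shows "conj_set G (g \<otimes> h) X = conj_set G g (conj_set G h X)"
  unfolding conj_set_def image_image
proof (rule image_cong)
  fix x assume "x \<in> X"
  then have "x \<in> carrier G"
    using assms by blast
  then show "g \<otimes> h \<otimes> x \<otimes> inv (g \<otimes> h) = g \<otimes> (h \<otimes> x \<otimes> inv h) \<otimes> inv g"
    using assms by (simp add: m_assoc inv_mult_group)
qed simp

lemma conj_set_one: "X \<subseteq> carrier G \<Longrightarrow> conj_set G \<one> X = X"
  by (force simp: conj_set_def)

lemma conj_set_subset: "g \<in> carrier G \<Longrightarrow> X \<subseteq> carrier G \<Longrightarrow> conj_set G g X \<subseteq> carrier G"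
  by (auto simp: conj_set_def)

lemma conj_set_inv:
  assumes "g \<in> carrier G" "X \<subseteq> carrier G"
  shows "conj_set G (inv g) (conj_set G g X) = X" "conj_set G g (conj_set G (inv g) X) = X"
  using assms conj_set_mult[of "inv g" g X] conj_set_mult[of g "inv g" X]
  by (simp_all add: conj_set_one)

lemma conj_set_iff:
  assumes "g \<in> carrier G" "X \<subseteq> carrier G"
  shows "x \<in> conj_set G g X \<longleftrightarrow> x \<in> carrier G \<and> inv g \<otimes> x \<otimes> g \<in> X"
proof
  assume "x \<in> conj_set G g X"
  then show "x \<in> carrier G \<and> inv g \<otimes> x \<otimes> g \<in> X"
    using assms by (auto simp: conj_set_def m_assoc subset_iff)
next
  assume "x \<in> carrier G \<and> inv g \<otimes> x \<otimes> g \<in> X"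
  then show "x \<in> conj_set G g X"
    using assms unfolding conj_set_def
    by (intro image_eqI[where x = "inv g \<otimes> x \<otimes> g"]) (auto simp: m_assoc)
qed

lemma conj_set_subgroup:
  assumes "g \<in> carrier G" "subgroup X G"
  shows "subgroup (conj_set G g X) G"
proof (rule subgroupI)
  have X: "X \<subseteq> carrier G"
    using assms by (simp add: subgroup.subset)
  note iff = conj_set_iff[OF assms(1) X]
  show "conj_set G g X \<subseteq> carrier G"
    using assms(1) X by (rule conj_set_subset)
  show "conj_set G g X \<noteq> {}"
    using subgroup.one_closed[OF assms(2)] by (auto simp: conj_set_def)
  show "inv x \<in> conj_set G g X" if "x \<in> conj_set G g X" for x
  proof -
    have "inv g \<otimes> inv x \<otimes> g = inv (inv g \<otimes> x \<otimes> g)"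
      using that assms(1) by (simp add: iff inv_mult_group m_assoc)
    then show ?thesis
      using that subgroup.m_inv_closed[OF assms(2)] by (simp add: iff)
  qed
  show "x \<otimes> y \<in> conj_set G g X" if "x \<in> conj_set G g X" "y \<in> conj_set G g X" for x y
  proof -
    have "inv g \<otimes> (x \<otimes> y) \<otimes> g = (inv g \<otimes> x \<otimes> g) \<otimes> (inv g \<otimes> y \<otimes> g)"
      using that assms(1) by (simp add: iff m_assoc)
    then show ?thesis
      using that subgroup.m_closed[OF assms(2)] by (simp add: iff)
  qed
qed

lemma r_coset_eq_iff:
  assumes "subgroup U G" "x \<in> carrier G" "y \<in> carrier G"
  shows "U #> x = U #> y \<longleftrightarrow> y \<otimes> inv x \<in> U"
proof -
  have "U #> x = U #> y \<longleftrightarrow> y \<in> U #> x"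
    using assms repr_independence[of y U x] repr_independenceD[of U y x] by blast
  then show ?thesis
    using subgroup.rcos_module[OF assms(1) is_group assms(2,3)] by simp
qed

end

lemma compact_open_subgroupD:
  assumes "compact_open_subgroup G T U"
  shows "subgroup U G" "compactin T U" "openin T U"
  using assms by (simp_all add: compact_open_subgroup_def)

context topological_group
begin

lemma continuous_map_left_mult:
  "g \<in> carrier G \<Longrightarrow> continuous_map T T (\<lambda>x. g \<otimes> x)"
  using continuous_map_compose[of T "prod_topology T T" "\<lambda>x. (g, x)", OF _ continuous_mult]
  by (simp add: o_def continuous_map_pairwise topspace_carrier)

lemma continuous_map_right_mult:
  "g \<in> carrier G \<Longrightarrow> continuous_map T T (\<lambda>x. x \<otimes> g)"
  using continuous_map_compose[of T "prod_topology T T" "\<lambda>x. (x, g)", OF _ continuous_mult]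
  by (simp add: o_def continuous_map_pairwise topspace_carrier)

lemma continuous_map_conj:
  assumes "g \<in> carrier G" "h \<in> carrier G"
  shows "continuous_map T T (\<lambda>x. g \<otimes> x \<otimes> h)"
  using continuous_map_compose[OF continuous_map_left_mult[OF assms(1)]
      continuous_map_right_mult[OF assms(2)]]
  by (simp add: o_def)

lemma openin_r_coset:
  assumes "openin T U" "g \<in> carrier G"
  shows "openin T (U #> g)"
proof -
  have U: "U \<subseteq> carrier G"
    using assms openin_subset topspace_carrier by auto
  have "U #> g = {x \<in> topspace T. x \<otimes> inv g \<in> U}"
  proof (intro Set.set_eqI iffI)
    fix x assume x: "x \<in> {x \<in> topspace T. x \<otimes> inv g \<in> U}"
    then have "x = (x \<otimes> inv g) \<otimes> g"
      using assms by (simp add: topspace_carrier m_assoc)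
    with x show "x \<in> U #> g"
      unfolding r_coset_def by blast
  next
    fix x assume "x \<in> U #> g"
    then obtain u where "u \<in> U" "x = u \<otimes> g"
      unfolding r_coset_def by blast
    moreover have "u \<in> carrier G"
      using U \<open>u \<in> U\<close> by blast
    ultimately show "x \<in> {x \<in> topspace T. x \<otimes> inv g \<in> U}"
      using assms by (simp add: topspace_carrier m_assoc)
  qed
  then show ?thesis
    using openin_continuous_map_preimage[OF continuous_map_right_mult assms(1)] assms(2) by simp
qed

lemma compact_open_conj_set:
  assumes "compact_open_subgroup G T U" "g \<in> carrier G"
  shows "compact_open_subgroup G T (conj_set G g U)"
proof -
  note U = compact_open_subgroupD[OF assms(1)]
  have sub: "U \<subseteq> carrier G"
    using U by (simp add: subgroup.subset)
  have "conj_set G g U = {x \<in> topspace T. inv g \<otimes> x \<otimes> g \<in> U}"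
    using conj_set_iff[OF assms(2) sub] by (auto simp: topspace_carrier)
  then have "openin T (conj_set G g U)"
    using openin_continuous_map_preimage[OF continuous_map_conj U(3)] assms(2) by simp
  moreover have "compactin T (conj_set G g U)"
    unfolding conj_set_def using assms(2) by (intro image_compactin[OF U(2)] continuous_map_conj inv_closed)
  ultimately show ?thesis
    using U assms(2) by (simp add: compact_open_subgroup_def conj_set_subgroup)
qed

text \<open>Cosets of an open subgroup are open and pairwise disjoint, so a finite subcover of
  \<open>C\<close> already contains every coset that meets \<open>C\<close>.\<close>

lemma finite_r_cosets_compact:
  assumes C: "compactin T C" and U: "subgroup U G" "openin T U"
  shows "finite ((\<lambda>g. U #> g) ` C)"
proof -
  have CG: "C \<subseteq> carrier G"
    using C compactin_subset_topspace topspace_carrier by auto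
  have "\<exists>\<F>. finite \<F> \<and> \<F> \<subseteq> (\<lambda>g. U #> g) ` C \<and> C \<subseteq> \<Union>\<F>"
  proof (rule compactinD[OF C])
    show "openin T X" if "X \<in> (\<lambda>g. U #> g) ` C" for X
      using that CG U(2) openin_r_coset by blast
    show "C \<subseteq> \<Union>((\<lambda>g. U #> g) ` C)"
      using CG rcos_self[OF _ U(1)] by blast
  qed
  then obtain \<F> where \<F>: "finite \<F>" "\<F> \<subseteq> (\<lambda>g. U #> g) ` C" "C \<subseteq> \<Union>\<F>"
    by blast
  have "(\<lambda>g. U #> g) ` C \<subseteq> \<F>"
  proof
    fix X assume "X \<in> (\<lambda>g. U #> g) ` C"
    then obtain g where g: "g \<in> C" "X = U #> g" by blast
    then obtain Y where Y: "Y \<in> \<F>" "g \<in> Y"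
      using \<F>(3) by blast
    then obtain h where "h \<in> C" "Y = U #> h"
      using \<F>(2) by blast
    with Y have h: "h \<in> C" "U #> h \<in> \<F>" "g \<in> U #> h" by simp_all
    then have "U #> h = U #> g"
      using CG U(1) by (intro repr_independence) blast+
    with g h show "X \<in> \<F>" by simp
  qed
  with \<F>(1) show ?thesis
    using finite_subset by blast
qed

lemma open_subgroup_closedin:
  assumes U: "subgroup U G" "openin T U"
  shows "closedin T U"
proof -
  have "topspace T - U = (\<Union>g \<in> carrier G - U. U #> g)"
  proof (intro Set.set_eqI iffI)
    fix x assume "x \<in> topspace T - U"
    then have "x \<in> carrier G - U"
      by (simp add: topspace_carrier)
    then show "x \<in> (\<Union>g \<in> carrier G - U. U #> g)"
      using rcos_self[OF _ U(1)] by blast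
  next
    fix x assume "x \<in> (\<Union>g \<in> carrier G - U. U #> g)"
    then obtain g where g: "g \<in> carrier G" "g \<notin> U" "x \<in> U #> g" by blast
    then obtain u where u: "u \<in> U" "x = u \<otimes> g"
      unfolding r_coset_def by blast
    have uG: "u \<in> carrier G"
      using u subgroup.subset[OF U(1)] by blast
    have "g = inv u \<otimes> x"
      using u uG g by simp
    then have "x \<notin> U"
      using g(2) subgroup.m_closed[OF U(1) subgroup.m_inv_closed[OF U(1) u(1)]] by blast
    then show "x \<in> topspace T - U"
      using u uG g by (simp add: topspace_carrier)
  qed
  moreover have "openin T (\<Union>g \<in> carrier G - U. U #> g)"
    using openin_r_coset[OF U(2)] by blast
  ultimately show ?thesis
    using U by (simp add: closedin_def openin_subset)
qed

text \<open>The closure of \<open>{\<one>}\<close> is connected, hence a single point. The diagonal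
  is its preimage under the continuous map taking \<open>(x, y)\<close> to
  \<open>inv x \<otimes> y\<close>, hence closed.\<close>

lemma Hausdorff_if_totally_disconnected:
  assumes "totally_disconnected_space T"
  shows "Hausdorff_space T"
proof -
  have "connectedin T (T closure_of {\<one>})"
    by (intro connectedin_closure_of) (simp add: topspace_carrier)
  moreover have "\<one> \<in> T closure_of {\<one>}"
    using closure_of_subset[of "{\<one>}" T] by (simp add: topspace_carrier)
  ultimately have "T closure_of {\<one>} = {\<one>}"
    using assms unfolding totally_disconnected_space_def by blast
  then have cl: "closedin T {\<one>}"
    by (metis closedin_closure_of)
  have "continuous_map (prod_topology T T) T (\<lambda>p. inv (fst p) \<otimes> snd p)"
  proof -
    have "continuous_map (prod_topology T T) (prod_topology T T) (\<lambda>p. (inv (fst p), snd p))"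
      using continuous_map_compose[OF continuous_map_fst continuous_inv]
      by (simp add: continuous_map_pairwise o_def continuous_map_snd)
    from continuous_map_compose[OF this continuous_mult] show ?thesis
      by (simp add: o_def)
  qed
  from closedin_continuous_map_preimage[OF this cl]
  have "closedin (prod_topology T T)
    {p \<in> topspace (prod_topology T T). inv (fst p) \<otimes> snd p \<in> {\<one>}}" .
  moreover have "{p \<in> topspace (prod_topology T T). inv (fst p) \<otimes> snd p \<in> {\<one>}}
      = (\<lambda>x. (x, x)) ` topspace T"
  proof -
    have "inv x \<otimes> y = \<one> \<longleftrightarrow> x = y" if "x \<in> carrier G" "y \<in> carrier G" for x y
      using that inv_solve_left[of \<one> x y] by auto
    then show ?thesis
      by (auto simp: topspace_carrier)
  qed
  ultimately show ?thesis
    by (simp add: Hausdorff_space_closedin_diagonal)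
qed

end

section \<open>Invariant subgroups of uniformly commensurable families\<close>

context group
begin

lemma conj_set_r_coset:
  assumes "g \<in> carrier G" "X \<subseteq> carrier G" "k \<in> carrier G"
  shows "conj_set G g X #> (g \<otimes> k \<otimes> inv g) = conj_set G g (X #> k)"
proof -
  have "g \<otimes> x \<otimes> inv g \<otimes> (g \<otimes> k \<otimes> inv g) = g \<otimes> (x \<otimes> k) \<otimes> inv g" if "x \<in> X" for x
  proof -
    have "x \<in> carrier G"
      using that assms(2) by blast
    then show ?thesis
      using assms by (simp add: m_assoc)
  qed
  then show ?thesis
    by (auto simp: conj_set_def r_coset_def)
qed

lemma r_cosets_conj_set:
  assumes "g \<in> carrier G" "X \<subseteq> carrier G" "K \<subseteq> carrier G"
  shows "(\<lambda>k. conj_set G g X #> k) ` conj_set G g K = conj_set G g ` (\<lambda>k. X #> k) ` K"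
proof -
  have "conj_set G g X #> (g \<otimes> k \<otimes> inv g) = conj_set G g (X #> k)" if "k \<in> K" for k
    using that assms by (intro conj_set_r_coset) auto
  then show ?thesis
    unfolding conj_set_def[of G g K] image_image by (intro image_cong refl)
qed

lemma conj_set_Inter:
  assumes "g \<in> carrier G" "A \<noteq> {}" "\<And>X. X \<in> A \<Longrightarrow> X \<subseteq> carrier G"
  shows "conj_set G g (\<Inter>A) = \<Inter>(conj_set G g ` A)"
proof -
  have "\<Inter>A \<subseteq> carrier G"
    using assms(2,3) by blast
  then show ?thesis
    using assms by (auto simp: conj_set_iff)
qed

lemma conj_generate_subset:
  assumes g: "g \<in> carrier G" and A: "A \<subseteq> carrier G" "conj_set G g A \<subseteq> A"
  shows "conj_set G g (generate G A) \<subseteq> generate G A"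
proof -
  have "g \<otimes> x \<otimes> inv g \<in> generate G A" if "x \<in> generate G A" for x
    using that
  proof (induction rule: generate.induct)
    case one
    then show ?case
      using g by (simp add: generate.one)
  next
    case (incl h)
    then show ?case
      using A by (intro generate.incl) (auto simp: conj_set_def)
  next
    case (inv h)
    then have "g \<otimes> h \<otimes> inv g \<in> A" "h \<in> carrier G"
      using A by (auto simp: conj_set_def)
    moreover have "g \<otimes> inv h \<otimes> inv g = inv (g \<otimes> h \<otimes> inv g)"
      using g \<open>h \<in> carrier G\<close> by (simp add: inv_mult_group m_assoc)
    ultimately show ?case
      by (simp add: generate.inv)
  next
    case (eng h1 h2)
    then have h: "h1 \<in> carrier G" "h2 \<in> carrier G"
      using generate_in_carrier[OF A(1)] by auto
    have "g \<otimes> (h1 \<otimes> h2) \<otimes> inv g = (g \<otimes> h1 \<otimes> inv g) \<otimes> (g \<otimes> h2 \<otimes> inv g)"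
      using g h by (simp add: m_assoc)
    then show ?case
      using generate.eng[OF eng.IH] by simp
  qed
  then show ?thesis
    by (auto simp: conj_set_def)
qed

text \<open>The theorem of Schlichting and Bergman--Lenstra. Among the finite intersections \<open>K\<close> of members
  of \<open>F\<close> take those for which the maximal number of cosets of a member of \<open>F\<close> met by \<open>K\<close> is minimal.
  If \<open>X\<close> attains this maximum for \<open>K\<close>, then \<open>X K\<close> does not change when \<open>K\<close> is enlarged, so the
  group generated by all these \<open>K\<close> remains inside products of two members of \<open>F\<close>.\<close>

theorem invariant_subgroup_of_uniformly_commensurable_family:
  assumes F: "F \<noteq> {}" "\<And>X. X \<in> F \<Longrightarrow> subgroup X G"
    and bound: "\<And>X Y. X \<in> F \<Longrightarrow> Y \<in> F \<Longrightarrow>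
      finite ((\<lambda>y. X #> y) ` Y) \<and> card ((\<lambda>y. X #> y) ` Y) \<le> n"
  obtains N A where "subgroup N G" "A \<subseteq> F" "finite A" "A \<noteq> {}" "\<Inter>A \<subseteq> N"
    "\<forall>x\<in>N. \<exists>X\<in>F. \<exists>Y\<in>F. \<exists>u\<in>X. \<exists>v\<in>Y. x = u \<otimes> v"
    "\<forall>g\<in>carrier G. conj_set G g ` F = F \<longrightarrow> conj_set G g N = N"
proof -
  define FI where "FI = {\<Inter>A | A. A \<subseteq> F \<and> finite A \<and> A \<noteq> {}}"
  define cs where "cs K X = (\<lambda>k. X #> k) ` K" for K X
  have FG: "X \<subseteq> carrier G" if "X \<in> F" for X
    using F(2)[OF that] by (rule subgroup.subset)
  have FI_sub: "subgroup K G" if K: "K \<in> FI" for K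
  proof -
    obtain A where "K = \<Inter>A" "A \<subseteq> F" "A \<noteq> {}"
      using K by (auto simp: FI_def)
    then show ?thesis
      using F(2) subgroups_Inter[of A] by blast
  qed
  have FI_carrier: "K \<subseteq> carrier G" if "K \<in> FI" for K
    using FI_sub[OF that] by (rule subgroup.subset)
  have FI_le: "\<exists>Y\<in>F. K \<subseteq> Y" if "K \<in> FI" for K
    using that unfolding FI_def by blast
  have FI_Int: "K \<inter> L \<in> FI" if "K \<in> FI" "L \<in> FI" for K L
  proof -
    obtain A B where AB: "K = \<Inter>A" "A \<subseteq> F" "finite A" "A \<noteq> {}" "L = \<Inter>B" "B \<subseteq> F" "finite B" "B \<noteq> {}"
      using \<open>K \<in> FI\<close> \<open>L \<in> FI\<close> unfolding FI_def by auto
    then have "K \<inter> L = \<Inter>(A \<union> B) \<and> A \<union> B \<subseteq> F \<and> finite (A \<union> B) \<and> A \<union> B \<noteq> {}"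
      by (simp add: Inter_Un_distrib)
    then show ?thesis
      unfolding FI_def by (intro CollectI exI)
  qed
  have cs_mono: "cs K X \<subseteq> cs L X" if "K \<subseteq> L" for K L X
    using that by (auto simp: cs_def)
  have cs_fin: "finite (cs K X)" "card (cs K X) \<le> n" if "K \<in> FI" "X \<in> F" for K X
  proof -
    obtain Y where Y: "Y \<in> F" "K \<subseteq> Y"
      using FI_le[OF \<open>K \<in> FI\<close>] by blast
    have "finite (cs Y X)" "card (cs Y X) \<le> n"
      using bound[OF \<open>X \<in> F\<close> Y(1)] by (auto simp: cs_def)
    then show "finite (cs K X)" "card (cs K X) \<le> n"
      using cs_mono[OF Y(2), of X] by (auto intro: finite_subset order_trans[OF card_mono])
  qed
  define m where "m = (LEAST m. \<exists>K\<in>FI. \<forall>X\<in>F. card (cs K X) \<le> m)"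
  define S where "S = {K \<in> FI. \<forall>X\<in>F. card (cs K X) \<le> m}"
  obtain X0 where "X0 \<in> F"
    using F(1) by blast
  then have "\<Inter>{X0} \<in> FI"
    unfolding FI_def by blast
  then have "\<exists>K\<in>FI. \<forall>X\<in>F. card (cs K X) \<le> n"
    using cs_fin by blast
  then have "\<exists>K\<in>FI. \<forall>X\<in>F. card (cs K X) \<le> m"
    unfolding m_def by (rule LeastI[of "\<lambda>m. \<exists>K\<in>FI. \<forall>X\<in>F. card (cs K X) \<le> m"])
  then obtain K0 where K0: "K0 \<in> S"
    unfolding S_def by blast
  have S_Int: "K \<inter> L \<in> S" if K: "K \<in> S" "L \<in> S" for K L
  proof -
    have "card (cs (K \<inter> L) X) \<le> m" if "X \<in> F" for X
    proof -
      have "card (cs (K \<inter> L) X) \<le> card (cs K X)"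
        using K cs_fin \<open>X \<in> F\<close> by (intro card_mono cs_mono) (auto simp: S_def)
      also have "\<dots> \<le> m"
        using K \<open>X \<in> F\<close> by (simp add: S_def)
      finally show ?thesis .
    qed
    then show ?thesis
      using K FI_Int by (simp add: S_def)
  qed
  have attained: "\<exists>X\<in>F. card (cs K X) = m" if K: "K \<in> S" for K
  proof (rule ccontr)
    assume "\<not> ?thesis"
    then have less: "card (cs K X) < m" if "X \<in> F" for X
      using K that by (force simp: S_def)
    then have "0 < m"
      using \<open>X0 \<in> F\<close> by fastforce
    have "\<forall>X\<in>F. card (cs K X) \<le> m - 1"
      using less by fastforce
    then have "\<exists>K\<in>FI. \<forall>X\<in>F. card (cs K X) \<le> m - 1"
      using K by (auto simp: S_def)
    then have "m \<le> m - 1"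
      unfolding m_def by (rule Least_le)
    with \<open>0 < m\<close> show False by simp
  qed
  \<comment> \<open>The larger \<open>L\<close> meets at least the cosets that \<open>K\<close>
    meets, and at most \<open>m\<close> of them.\<close>
  have stable: "cs K X = cs L X" if "K \<in> S" "L \<in> S" "K \<subseteq> L" "X \<in> F" "card (cs K X) = m" for K L X
    using that cs_fin cs_mono[of K L X] by (intro card_seteq) (auto simp: S_def)
  \<comment> \<open>Right multiplication by \<open>x\<close> maps the product \<open>X L\<close>
    into itself. Requiring this for all smaller \<open>L\<close> lets the condition pass to
    intersections, so a product of two such elements satisfies it for the intersection of their
    groups.\<close>
  define absorbs where "absorbs K x \<longleftrightarrow> (\<forall>L\<in>S. L \<subseteq> K \<longrightarrow>
    (\<forall>X\<in>F. card (cs L X) = m \<longrightarrow> (\<forall>k\<in>L. X #> (k \<otimes> x) \<in> cs L X)))" for K x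
  define good where "good x \<longleftrightarrow> x \<in> carrier G \<and> (\<exists>K\<in>S. absorbs K x)" for x
  have SG: "\<Union>S \<subseteq> carrier G"
    using FI_carrier by (auto simp: S_def)
  define N where "N = generate G (\<Union>S)"
  have good_mem: "good x" if "x \<in> K" "K \<in> S" for x K
  proof -
    have "X #> (k \<otimes> x) \<in> cs L X"
      if "L \<in> S" "L \<subseteq> K" "X \<in> F" "card (cs L X) = m" "k \<in> L" for L X k
    proof -
      have "subgroup K G"
        using \<open>K \<in> S\<close> FI_sub by (simp add: S_def)
      then have "k \<otimes> x \<in> K"
        using \<open>x \<in> K\<close> \<open>k \<in> L\<close> \<open>L \<subseteq> K\<close> by (intro subgroup.m_closed) auto
      then have "X #> (k \<otimes> x) \<in> cs K X"
        by (simp add: cs_def)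
      then show ?thesis
        using stable[of L K X] that \<open>K \<in> S\<close> by simp
    qed
    then have "absorbs K x"
      unfolding absorbs_def by blast
    then show ?thesis
      unfolding good_def using that SG by blast
  qed
  have good: "good x" if "x \<in> N" for x
    using that unfolding N_def
  proof (induction rule: generate.induct)
    case one
    have "\<one> \<in> K0"
      using K0 FI_sub by (simp add: S_def subgroup.one_closed)
    then show ?case
      using good_mem K0 by blast
  next
    case (incl h)
    then show ?case
      using good_mem by blast
  next
    case (inv h)
    then obtain K where "K \<in> S" "h \<in> K" by blast
    moreover have "inv h \<in> K"
      using calculation FI_sub by (simp add: S_def subgroup.m_inv_closed)
    ultimately show ?case
      using good_mem by blast
  next
    case (eng x y)
    obtain K where xG: "x \<in> carrier G" and K: "K \<in> S" and x: "absorbs K x"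
      using eng.IH(1) unfolding good_def by blast
    obtain L where yG: "y \<in> carrier G" and L: "L \<in> S" and y: "absorbs L y"
      using eng.IH(2) unfolding good_def by blast
    note xy = xG yG
    have "X #> (k \<otimes> (x \<otimes> y)) \<in> cs M X"
      if M: "M \<in> S" "M \<subseteq> K \<inter> L" "X \<in> F" "card (cs M X) = m" "k \<in> M" for M X k
    proof -
      have "X #> (k \<otimes> x) \<in> cs M X"
        using x M unfolding absorbs_def by blast
      then obtain l where l: "l \<in> M" "X #> (k \<otimes> x) = X #> l"
        unfolding cs_def by blast
      have G: "k \<in> carrier G" "l \<in> carrier G" "X \<subseteq> carrier G"
        using M l SG FG by auto
      have "X #> (k \<otimes> (x \<otimes> y)) = X #> (k \<otimes> x) #> y"
        using G xy by (simp add: coset_mult_assoc m_assoc)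
      also have "\<dots> = X #> (l \<otimes> y)"
        using G xy l by (simp add: coset_mult_assoc)
      also have "\<dots> \<in> cs M X"
        using y M l unfolding absorbs_def by blast
      finally show ?thesis .
    qed
    then have "absorbs (K \<inter> L) (x \<otimes> y)"
      unfolding absorbs_def by blast
    then show ?case
      unfolding good_def using xy S_Int[OF K L] by blast
  qed
  have product: "\<exists>X\<in>F. \<exists>Y\<in>F. \<exists>u\<in>X. \<exists>v\<in>Y. x = u \<otimes> v" if "x \<in> N" for x
  proof -
    from good[OF that] obtain K where xG: "x \<in> carrier G" and K: "K \<in> S" and x: "absorbs K x"
      unfolding good_def by blast
    obtain X where X: "X \<in> F" "card (cs K X) = m"
      using attained[OF K] by blast
    have "\<one> \<in> K"
      using K FI_sub by (simp add: S_def subgroup.one_closed)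
    then have "X #> (\<one> \<otimes> x) \<in> cs K X"
      using x K X unfolding absorbs_def by blast
    then obtain v where v: "v \<in> K" "X #> x = X #> v"
      using xG by (auto simp: cs_def)
    have "x \<in> X #> v"
      using rcos_self[OF xG F(2)[OF X(1)]] v(2) by simp
    then obtain u where "u \<in> X" "x = u \<otimes> v"
      unfolding r_coset_def by blast
    moreover obtain Y where "Y \<in> F" "K \<subseteq> Y"
      using FI_le K unfolding S_def by blast
    ultimately show ?thesis
      using X v by blast
  qed
  \<comment> \<open>Conjugation by \<open>g\<close> permutes \<open>F\<close> and carries cosets to
    cosets, so it preserves the minimality that defines \<open>S\<close>.\<close>
  have conj_S: "conj_set G g K \<in> S" if g: "g \<in> carrier G" "conj_set G g ` F = F" and K: "K \<in> S" for g K
  proof -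
    obtain A where A: "K = \<Inter>A" "A \<subseteq> F" "finite A" "A \<noteq> {}"
      using K by (auto simp: S_def FI_def)
    have "conj_set G g K = \<Inter>(conj_set G g ` A)"
      unfolding A(1) using A(2) FG by (intro conj_set_Inter[OF g(1) A(4)]) blast
    moreover have "conj_set G g ` A \<subseteq> F"
      using A g by blast
    ultimately have "conj_set G g K \<in> FI"
      unfolding FI_def using A by blast
    moreover have "card (cs (conj_set G g K) X) \<le> m" if X: "X \<in> F" for X
    proof -
      obtain Y where Y: "Y \<in> F" "X = conj_set G g Y"
        using X g(2) by blast
      have KFI: "K \<in> FI"
        using K by (simp add: S_def)
      have "cs (conj_set G g K) X = conj_set G g ` cs K Y"
        unfolding cs_def Y(2) by (rule r_cosets_conj_set[OF g(1) FG[OF Y(1)] FI_carrier[OF KFI]])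
      then have "card (cs (conj_set G g K) X) \<le> card (cs K Y)"
        using cs_fin[OF KFI Y(1)] by (simp add: card_image_le)
      also have "\<dots> \<le> m"
        using K Y by (simp add: S_def)
      finally show ?thesis .
    qed
    ultimately show ?thesis
      by (simp add: S_def)
  qed
  have NG: "N \<subseteq> carrier G"
    unfolding N_def using generate_incl[OF SG] .
  have conj_N: "conj_set G g N \<subseteq> N" if g: "g \<in> carrier G" "conj_set G g ` F = F" for g
  proof -
    have "conj_set G g (\<Union>S) \<subseteq> \<Union>S"
      using conj_S[OF g] unfolding conj_set_def by blast
    then show ?thesis
      unfolding N_def using g SG by (intro conj_generate_subset)
  qed
  obtain A where A: "A \<subseteq> F" "finite A" "A \<noteq> {}" "K0 = \<Inter>A"
    using K0 by (auto simp: S_def FI_def)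
  show thesis
  proof (rule that)
    show "subgroup N G"
      unfolding N_def using SG by (rule generate_is_subgroup)
    show "A \<subseteq> F" "finite A" "A \<noteq> {}" by fact+
    show "\<Inter>A \<subseteq> N"
      using A K0 unfolding N_def by (blast intro: generate.incl)
    have "conj_set G g N = N" if g: "g \<in> carrier G" "conj_set G g ` F = F" for g
    proof
      show "conj_set G g N \<subseteq> N"
        using g by (rule conj_N)
      have "conj_set G (inv g) (conj_set G g X) = X" if "X \<in> F" for X
        using g FG[OF that] by (simp add: conj_set_inv)
      then have "conj_set G (inv g) ` conj_set G g ` F = F"
        unfolding image_image by simp
      then have "conj_set G (inv g) ` F = F"
        using g(2) by simp
      then have "conj_set G (inv g) N \<subseteq> N"
        using g(1) by (intro conj_N) auto
      then have "conj_set G g (conj_set G (inv g) N) \<subseteq> conj_set G g N"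
        by (rule conj_set_mono)
      then show "N \<subseteq> conj_set G g N"
        using g NG by (simp add: conj_set_inv)
    qed
    then show "\<forall>g\<in>carrier G. conj_set G g ` F = F \<longrightarrow> conj_set G g N = N"
      by blast
    show "\<forall>x\<in>N. \<exists>X\<in>F. \<exists>Y\<in>F. \<exists>u\<in>X. \<exists>v\<in>Y. x = u \<otimes> v"
      using product by blast
  qed
qed

end

section \<open>Compact open subgroups normalised by an element\<close>

context topological_group
begin

lemma openin_subgroup_if_contains_open:
  assumes N: "subgroup N G" and W: "openin T W" "\<one> \<in> W" "W \<subseteq> N"
  shows "openin T N"
proof -
  have NG: "N \<subseteq> carrier G"
    using N by (rule subgroup.subset)
  have "N = (\<Union>n\<in>N. W #> n)"
  proof (intro equalityI subsetI)
    fix x assume "x \<in> N"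
    moreover have "x \<in> W #> x"
      using W(2) NG \<open>x \<in> N\<close> unfolding r_coset_def by force
    ultimately show "x \<in> (\<Union>n\<in>N. W #> n)" by blast
  next
    fix x assume "x \<in> (\<Union>n\<in>N. W #> n)"
    then obtain w n where "w \<in> W" "n \<in> N" "x = w \<otimes> n"
      unfolding r_coset_def by blast
    then show "x \<in> N"
      using W(3) subgroup.m_closed[OF N] by blast
  qed
  moreover have "openin T (\<Union>n\<in>N. W #> n)"
    using openin_r_coset[OF W(1)] NG by blast
  ultimately show ?thesis by simp
qed

lemma compactin_set_mult:
  assumes "compactin T B" "compactin T C"
  shows "compactin T ((\<lambda>(x, y). x \<otimes> y) ` (B \<times> C))"
  using assms continuous_mult by (intro image_compactin) (auto simp: compactin_Times)

text \<open>The conjugates of \<open>U\<close> by powers of \<open>a\<close> form an invariant,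
  uniformly commensurable family. The resulting invariant group contains a finite intersection of
  them, so it is open and therefore closed; it lies in the compact set \<open>B B\<close>, so it is
  compact.\<close>

lemma normalises_compact_open_subgroup:
  assumes a: "a \<in> carrier G" and U: "compact_open_subgroup G T U" and B: "compactin T B"
    and sub: "\<And>k::int. conj_set G (a [^] k) U \<subseteq> B"
  obtains V where "compact_open_subgroup G T V" "conj_set G a V = V"
proof -
  define F where "F = range (\<lambda>k::int. conj_set G (a [^] k) U)"
  note U' = compact_open_subgroupD[OF U]
  have UG: "U \<subseteq> carrier G"
    using U'(1) by (rule subgroup.subset)
  have BG: "B \<subseteq> carrier G"
    using B compactin_subset_topspace topspace_carrier by blast
  \<comment> \<open>Conjugating back moves \<open>X\<close> to \<open>U\<close> and \<open>Y\<close>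
    to another conjugate inside \<open>B\<close>, so the cosets of \<open>U\<close> that meet
    \<open>B\<close> give a bound independent of \<open>X\<close> and \<open>Y\<close>.\<close>
  have cosets: "finite ((\<lambda>y. X #> y) ` Y) \<and> card ((\<lambda>y. X #> y) ` Y) \<le> card ((\<lambda>g. U #> g) ` B)"
    if XY: "X \<in> F" "Y \<in> F" for X Y
  proof -
    obtain i j :: int where ij: "X = conj_set G (a [^] i) U" "Y = conj_set G (a [^] j) U"
      using XY by (auto simp: F_def)
    define Z where "Z = conj_set G (a [^] (j - i)) U"
    have ZG: "Z \<subseteq> carrier G"
      unfolding Z_def using a UG by (intro conj_set_subset) auto
    have "Y = conj_set G (a [^] i) Z"
      unfolding Z_def ij using a UG int_pow_mult[of a i "j - i"]
      by (simp flip: conj_set_mult)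
    then have eq: "(\<lambda>y. X #> y) ` Y = conj_set G (a [^] i) ` (\<lambda>g. U #> g) ` Z"
      using r_cosets_conj_set[of "a [^] i" U Z] a UG ZG ij by simp
    have "(\<lambda>g. U #> g) ` Z \<subseteq> (\<lambda>g. U #> g) ` B"
      using sub[of "j - i"] by (auto simp: Z_def)
    moreover have fin: "finite ((\<lambda>g. U #> g) ` B)"
      by (rule finite_r_cosets_compact[OF B U'(1,3)])
    ultimately have Z: "finite ((\<lambda>g. U #> g) ` Z)" "card ((\<lambda>g. U #> g) ` Z) \<le> card ((\<lambda>g. U #> g) ` B)"
      by (auto intro: finite_subset card_mono)
    then show ?thesis
      unfolding eq using card_image_le[OF Z(1), of "conj_set G (a [^] i)"] by simp
  qed
  have F_cos: "compact_open_subgroup G T X" if "X \<in> F" for X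
    using that compact_open_conj_set[OF U] a by (auto simp: F_def)
  have F_ne: "F \<noteq> {}"
    by (simp add: F_def)
  obtain N A where N: "subgroup N G" and A: "A \<subseteq> F" "finite A" "A \<noteq> {}" "\<Inter>A \<subseteq> N"
    and mem: "\<forall>x\<in>N. \<exists>X\<in>F. \<exists>Y\<in>F. \<exists>u\<in>X. \<exists>v\<in>Y. x = u \<otimes> v"
    and invariant: "\<forall>g\<in>carrier G. conj_set G g ` F = F \<longrightarrow> conj_set G g N = N"
    by (rule invariant_subgroup_of_uniformly_commensurable_family[OF F_ne
          compact_open_subgroupD(1)[OF F_cos] cosets])
  have "openin T (\<Inter>A)"
    using A compact_open_subgroupD(3)[OF F_cos] by (intro openin_Inter) auto
  moreover have "\<one> \<in> \<Inter>A"
    using A subgroup.one_closed[OF compact_open_subgroupD(1)[OF F_cos]] by blast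
  ultimately have op: "openin T N"
    using openin_subgroup_if_contains_open[OF N] A by blast
  have "N \<subseteq> (\<lambda>(x, y). x \<otimes> y) ` (B \<times> B)"
  proof
    fix x assume "x \<in> N"
    with mem obtain X Y u v where "X \<in> F" "Y \<in> F" "u \<in> X" "v \<in> Y" "x = u \<otimes> v"
      by blast
    moreover have "X \<subseteq> B" "Y \<subseteq> B"
      using sub calculation by (auto simp: F_def)
    ultimately have "(u, v) \<in> B \<times> B" "x = (\<lambda>(x, y). x \<otimes> y) (u, v)"
      by auto
    then show "x \<in> (\<lambda>(x, y). x \<otimes> y) ` (B \<times> B)"
      by (intro image_eqI)
  qed
  then have "compactin T N"
    using closed_compactin[OF compactin_set_mult[OF B B]] open_subgroup_closedin[OF N op] by blast
  then have "compact_open_subgroup G T N"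
    using N op by (simp add: compact_open_subgroup_def)
  moreover have "conj_set G a N = N"
  proof (rule invariant[rule_format, OF a])
    have "conj_set G a (conj_set G (a [^] k) U) = conj_set G (a [^] (k + 1)) U" for k :: int
      using a UG int_pow_mult[of a 1 k] by (simp add: add.commute flip: conj_set_mult)
    then have "conj_set G a ` F = range (\<lambda>k::int. conj_set G (a [^] (k + 1)) U)"
      by (simp add: F_def image_image)
    also have "\<dots> = F"
      unfolding F_def
    proof (intro equalityI subsetI)
      fix X assume "X \<in> range (\<lambda>k::int. conj_set G (a [^] k) U)"
      then obtain k :: int where "X = conj_set G (a [^] (k - 1 + 1)) U" by auto
      then show "X \<in> range (\<lambda>k::int. conj_set G (a [^] (k + 1)) U)" by blast
    qed blast
    finally show "conj_set G a ` F = F" .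
  qed
  ultimately show thesis ..
qed

end

section \<open>Word length\<close>

lemma (in group) cayley_graph_left_mult:
  assumes "g \<in> carrier G" "K \<subseteq> carrier G" "(x, y) \<in> cayley_graph G K"
  shows "(g \<otimes> x, g \<otimes> y) \<in> cayley_graph G K"
  using assms by (auto simp: cayley_graph_def m_assoc subset_iff intro!: bexI)

lemma (in group) cayley_graph_relpow_left_mult:
  assumes "g \<in> carrier G" "K \<subseteq> carrier G" "(x, y) \<in> cayley_graph G K ^^ n"
  shows "(g \<otimes> x, g \<otimes> y) \<in> cayley_graph G K ^^ n"
  using assms(3)
proof (induction n arbitrary: y)
  case (Suc n)
  then obtain z where "(x, z) \<in> cayley_graph G K ^^ n" "(z, y) \<in> cayley_graph G K"
    by auto
  then show ?case
    using Suc.IH cayley_graph_left_mult[OF assms(1,2)] by (meson relpow_Suc_I)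
qed auto

text \<open>Edges multiply by generators on the right, so left translations are graph
  automorphisms.\<close>

lemma (in group) graph_dist_left_mult:
  assumes "K \<subseteq> carrier G" "g \<in> carrier G" "x \<in> carrier G" "y \<in> carrier G"
  shows "graph_dist (cayley_graph G K) (g \<otimes> x) (g \<otimes> y) = graph_dist (cayley_graph G K) x y"
proof -
  have "(g \<otimes> x, g \<otimes> y) \<in> cayley_graph G K ^^ n \<longleftrightarrow> (x, y) \<in> cayley_graph G K ^^ n" for n
    using cayley_graph_relpow_left_mult[OF assms(2,1), of x y n]
      cayley_graph_relpow_left_mult[OF inv_closed[OF assms(2)] assms(1), of "g \<otimes> x" "g \<otimes> y" n] assms
    by auto
  then show ?thesis
    by (simp add: graph_dist_def)
qed

definition word_length :: "('a, 'b) monoid_scheme \<Rightarrow> 'a set \<Rightarrow> 'a \<Rightarrow> real" where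
  "word_length G K g = graph_dist (cayley_graph G K) \<one>\<^bsub>G\<^esub> g"

lemma (in group) graph_dist_word_length:
  assumes "K \<subseteq> carrier G" "x \<in> carrier G" "y \<in> carrier G"
  shows "graph_dist (cayley_graph G K) x y = word_length G K (inv x \<otimes> y)"
  using graph_dist_left_mult[OF assms(1), of "inv x" x y] assms by (simp add: word_length_def)

lemma (in group) cayley_graph_path:
  assumes "generate G K = carrier G" "x \<in> carrier G" "y \<in> carrier G"
  shows "(x, y) \<in> cayley_graph G K ^^ (LEAST n. (x, y) \<in> cayley_graph G K ^^ n)"
proof -
  have "\<exists>n. (x, y) \<in> cayley_graph G K ^^ n"
    using cayley_graph_connected[OF assms] by (simp add: rtrancl_power)
  then show ?thesis by (rule LeastI_ex)
qed

lemma graph_dist_le: "(x, y) \<in> E ^^ n \<Longrightarrow> graph_dist E x y \<le> real n"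
  by (simp add: graph_dist_def Least_le)

lemma (in group) cayley_graph_relpow_carrier:
  assumes "(x, y) \<in> cayley_graph G K ^^ n" "x \<in> carrier G"
  shows "y \<in> carrier G"
  using assms by (cases n) (auto simp: cayley_graph_def)

text \<open>Doubling the inequality between Gromov products and cancelling the distances to the base
  point gives the symmetric form with \<open>D = 2 * \<delta>\<close>.\<close>

lemma gromov_hyperbolic_four_point:
  assumes "gromov_hyperbolic M d"
  obtains D where "\<And>x y z w. \<lbrakk>x \<in> M; y \<in> M; z \<in> M; w \<in> M\<rbrakk> \<Longrightarrow>
    d x z + d y w \<le> max (d x y + d z w) (d y z + d x w) + D"
proof -
  obtain \<delta> where \<delta>: "\<And>x y z w. \<lbrakk>w \<in> M; x \<in> M; y \<in> M; z \<in> M\<rbrakk> \<Longrightarrow>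
      min (gromov_product d w x y) (gromov_product d w y z) - \<delta> \<le> gromov_product d w x z"
    using assms unfolding gromov_hyperbolic_def by blast
  have "d x z + d y w \<le> max (d x y + d z w) (d y z + d x w) + 2 * \<delta>"
    if "x \<in> M" "y \<in> M" "z \<in> M" "w \<in> M" for x y z w
    using \<delta>[OF that(4,1,2,3)]
    by (auto simp: gromov_product_def min_def max_def field_simps split: if_splits)
  then show thesis ..
qed

lemma (in group) hyperbolic_length_word_length:
  assumes gen: "generate G K = carrier G"
    and hyp: "gromov_hyperbolic (carrier G) (graph_dist (cayley_graph G K))"
  obtains D where "hyperbolic_length G (word_length G K) D"
proof -
  let ?d = "graph_dist (cayley_graph G K)"
  have KG: "K \<subseteq> carrier G"
    using gen generate.incl[of _ K G] by blast
  interpret d: Metric_space "carrier G" ?d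
    using gen by (rule Metric_space_cayley_graph)
  obtain D where D: "\<And>x y z w. \<lbrakk>x \<in> carrier G; y \<in> carrier G; z \<in> carrier G; w \<in> carrier G\<rbrakk> \<Longrightarrow>
      ?d x z + ?d y w \<le> max (?d x y + ?d z w) (?d y z + ?d x w) + D"
    using gromov_hyperbolic_four_point[OF hyp] by metis
  have "hyperbolic_length G (word_length G K) D"
  proof
    show "word_length G K \<one> = 0"
      by (simp add: word_length_def)
    show "0 \<le> word_length G K x" for x
      by (simp add: word_length_def)
    show "word_length G K (inv x) = word_length G K x" if "x \<in> carrier G" for x
      using graph_dist_word_length[OF KG, of x \<one>] that d.commute[of x \<one>]
      by (simp add: word_length_def)
    show "word_length G K (x \<otimes> y) \<le> word_length G K x + word_length G K y"
      if "x \<in> carrier G" "y \<in> carrier G" for x y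
      using graph_dist_word_length[OF KG, of x "x \<otimes> y"] that d.triangle[of \<one> x "x \<otimes> y"]
      by (simp add: word_length_def)
    show "\<exists>y\<in>carrier G. word_length G K y = real n \<and>
        word_length G K (inv y \<otimes> x) = word_length G K x - real n"
      if x: "x \<in> carrier G" and n: "real n \<le> word_length G K x" for x n
    proof -
      \<comment> \<open>Cut a shortest path after \<open>n\<close> edges; the triangle inequality
        forces both pieces to be shortest as well.\<close>
      define m where "m = (LEAST n. (\<one>, x) \<in> cayley_graph G K ^^ n)"
      have m: "word_length G K x = real m"
        by (simp add: m_def word_length_def graph_dist_def)
      have "(\<one>, x) \<in> cayley_graph G K ^^ (n + (m - n))"
        using cayley_graph_path[OF gen one_closed x] n m by (simp add: m_def)
      then obtain y where y: "(\<one>, y) \<in> cayley_graph G K ^^ n" "(y, x) \<in> cayley_graph G K ^^ (m - n)"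
        unfolding relpow_add by blast
      have yG: "y \<in> carrier G"
        using cayley_graph_relpow_carrier[OF y(1)] by simp
      have "?d \<one> y \<le> n" "?d y x \<le> real (m - n)"
        using y by (auto intro: graph_dist_le)
      moreover have "?d \<one> x \<le> ?d \<one> y + ?d y x"
        using x yG by (intro d.triangle) auto
      ultimately have "?d \<one> y = n" "?d y x = real m - real n"
        using n m by (auto simp: word_length_def)
      then show ?thesis
        using yG x m graph_dist_word_length[OF KG yG x] by (intro bexI[of _ y]) (auto simp: word_length_def)
    qed
    show "word_length G K (inv x \<otimes> z) + word_length G K (inv y \<otimes> w)
        \<le> max (word_length G K (inv x \<otimes> y) + word_length G K (inv z \<otimes> w))
              (word_length G K (inv y \<otimes> z) + word_length G K (inv x \<otimes> w)) + D"
      if "x \<in> carrier G" "y \<in> carrier G" "z \<in> carrier G" "w \<in> carrier G" for x y z w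
      using D[OF that] that by (simp add: graph_dist_word_length[OF KG])
  qed
  then show thesis ..
qed

text \<open>Topology and length are linked through compactness and boundedness; continuity of the
  length function is not assumed.\<close>

locale hyperbolic_topological_group =
  topological_group G T + hyperbolic_length G len D
  for G :: "('a, 'b) monoid_scheme" (structure) and T :: "'a topology"
    and len :: "'a \<Rightarrow> real" and D :: real +
  assumes compact_ball: "compactin T {g \<in> carrier G. len g \<le> R}"
    and compact_bounded: "compactin T C \<Longrightarrow> \<exists>R. \<forall>g\<in>C. len g \<le> R"

text \<open>The endpoints of paths with \<open>n + 1\<close> edges from \<open>\<one>\<close> are
  products of endpoints of paths with \<open>n\<close> edges and generators or their inverses, so
  compactness follows by induction. A ball is a finite union of such sets.\<close>

lemma (in topological_group) compactin_word_ball: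
  assumes K: "compactin T K" and gen: "generate G K = carrier G"
  shows "compactin T {g \<in> carrier G. word_length G K g \<le> R}"
proof -
  let ?P = "\<lambda>n. {g. (\<one>, g) \<in> cayley_graph G K ^^ n}"
  have KG: "K \<subseteq> carrier G"
    using gen generate.incl[of _ K G] by blast
  have P: "compactin T (?P n)" for n
  proof (induction n)
    case 0
    have "?P 0 = {\<one>}" by auto
    then show ?case
      by (simp add: topspace_carrier)
  next
    case (Suc n)
    have K': "compactin T ((\<lambda>x. inv x) ` K)"
      using image_compactin[OF K continuous_inv] .
    let ?m = "\<lambda>(x, y). x \<otimes> y"
    have sub: "g \<in> carrier G" if "(\<one>, g) \<in> cayley_graph G K ^^ n" for g
      using cayley_graph_relpow_carrier[OF that] by simp
    have "?P (Suc n) = ?m ` (?P n \<times> K) \<union> ?m ` (?P n \<times> (\<lambda>x. inv x) ` K)"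
    proof (intro equalityI subsetI)
      fix g assume "g \<in> ?P (Suc n)"
      then obtain h where h: "h \<in> ?P n" "(h, g) \<in> cayley_graph G K"
        by auto
      then obtain s where s: "s \<in> K" "h \<in> carrier G" "g \<in> carrier G" "g = h \<otimes> s \<or> h = g \<otimes> s"
        by (auto simp: cayley_graph_def)
      moreover have "s \<in> carrier G"
        using s KG by blast
      ultimately consider "g = h \<otimes> s" | "g = h \<otimes> inv s"
        by (auto simp: m_assoc)
      then show "g \<in> ?m ` (?P n \<times> K) \<union> ?m ` (?P n \<times> (\<lambda>x. inv x) ` K)"
      proof cases
        case 1
        then have "g = ?m (h, s)" "(h, s) \<in> ?P n \<times> K"
          using h s by auto
        then show ?thesis by blast
      next
        case 2
        then have "g = ?m (h, inv s)" "(h, inv s) \<in> ?P n \<times> (\<lambda>x. inv x) ` K"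
          using h s by auto
        then show ?thesis by blast
      qed
    next
      fix g assume "g \<in> ?m ` (?P n \<times> K) \<union> ?m ` (?P n \<times> (\<lambda>x. inv x) ` K)"
      then obtain h s where h: "h \<in> ?P n" and s: "s \<in> K" and g: "g = h \<otimes> s \<or> g = h \<otimes> inv s"
        by auto
      have G: "h \<in> carrier G" "s \<in> carrier G"
        using h s sub KG by auto
      then have "g \<in> carrier G" "g = h \<otimes> s \<or> h = g \<otimes> s"
        using g by (auto simp: m_assoc)
      then have "(h, g) \<in> cayley_graph G K"
        using G s by (auto simp: cayley_graph_def)
      then show "g \<in> ?P (Suc n)"
        using h by auto
    qed
    then show ?case
      using compactin_set_mult[OF Suc K] compactin_set_mult[OF Suc K'] by (simp add: compactin_Un)
  qed
  have "{g \<in> carrier G. word_length G K g \<le> R} = \<Union>(?P ` {n. real n \<le> R})"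
  proof (intro equalityI subsetI)
    fix g assume "g \<in> {g \<in> carrier G. word_length G K g \<le> R}"
    then show "g \<in> \<Union>(?P ` {n. real n \<le> R})"
      using cayley_graph_path[OF gen one_closed, of g] by (auto simp: word_length_def graph_dist_def)
  next
    fix g assume "g \<in> \<Union>(?P ` {n. real n \<le> R})"
    then obtain n where n: "(\<one>, g) \<in> cayley_graph G K ^^ n" "real n \<le> R" by blast
    have "word_length G K g \<le> n"
      unfolding word_length_def using n(1) by (rule graph_dist_le)
    moreover have "g \<in> carrier G"
      using cayley_graph_relpow_carrier[OF n(1)] by simp
    ultimately show "g \<in> {g \<in> carrier G. word_length G K g \<le> R}"
      using n(2) by simp
  qed
  moreover have "finite {n. real n \<le> R}"
    by (rule finite_subset[of _ "{..nat \<lfloor>R\<rfloor>}"]) (auto simp: le_nat_floor)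
  ultimately show ?thesis
    using P by (auto intro: compactin_Union)
qed

text \<open>By Baire's theorem some ball has an interior point.\<close>

lemma (in topological_group) compact_imp_bounded:
  assumes lc: "locally_compact_space T" and H: "Hausdorff_space T"
    and len: "hyperbolic_length G len D"
    and ball: "\<And>R. compactin T {g \<in> carrier G. len g \<le> R}" and C: "compactin T C"
  shows "\<exists>R. \<forall>g\<in>C. len g \<le> R"
proof -
  interpret hyperbolic_length G len D by (rule len)
  let ?B = "\<lambda>n. {g \<in> carrier G. len g \<le> real n}"
  have CG: "C \<subseteq> carrier G"
    using C compactin_subset_topspace topspace_carrier by blast
  have "\<exists>n. T interior_of ?B n \<noteq> {}"
  proof (rule ccontr)
    assume "\<not> ?thesis"
    then have "closedin T X \<and> T interior_of X = {}" if "X \<in> range ?B" for X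
      using that compactin_imp_closedin[OF H ball] by blast
    then have "T interior_of \<Union>(range ?B) = {}"
      using lc H locally_compact_Hausdorff_imp_regular_space
      by (intro Baire_category_alt) auto
    moreover have "\<Union>(range ?B) = topspace T"
      using real_arch_simple by (auto simp: topspace_carrier)
    ultimately have "topspace T = {}"
      by simp
    then show False
      using one_closed topspace_carrier by blast
  qed
  then obtain n w where w: "w \<in> T interior_of ?B n" by blast
  define W where "W = T interior_of ?B n"
  have W: "openin T W" "w \<in> W" "W \<subseteq> ?B n"
    using w interior_of_subset[of T "?B n"] by (auto simp: W_def)
  have wG: "w \<in> carrier G"
    using W by blast
  \<comment> \<open>The open set \<open>W\<close> need not contain \<open>\<one>\<close>, so its
    translate is chosen to carry \<open>w\<close> to \<open>c\<close>.\<close>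
  have mem: "c \<in> W #> (inv w \<otimes> c)" if "c \<in> C" for c
  proof -
    have "c \<in> carrier G"
      using that CG by blast
    then have "c = w \<otimes> (inv w \<otimes> c)"
      using wG by simp
    then show ?thesis
      using W(2) unfolding r_coset_def by blast
  qed
  have "\<exists>\<F>. finite \<F> \<and> \<F> \<subseteq> (\<lambda>c. W #> (inv w \<otimes> c)) ` C \<and> C \<subseteq> \<Union>\<F>"
  proof (rule compactinD[OF C])
    show "openin T X" if "X \<in> (\<lambda>c. W #> (inv w \<otimes> c)) ` C" for X
      using that CG wG openin_r_coset[OF W(1)] by blast
    show "C \<subseteq> \<Union>((\<lambda>c. W #> (inv w \<otimes> c)) ` C)"
      using mem by blast
  qed
  then obtain A where A: "A \<subseteq> C" "finite A" "C \<subseteq> \<Union>((\<lambda>c. W #> (inv w \<otimes> c)) ` A)"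
    by (metis finite_subset_image)
  define R where "R = (\<Sum>c\<in>A. len (inv w \<otimes> c))"
  have "len g \<le> real n + R" if "g \<in> C" for g
  proof -
    have "g \<in> \<Union>((\<lambda>c. W #> (inv w \<otimes> c)) ` A)"
      using A(3) that by (rule subsetD)
    then obtain c where c: "c \<in> A" "g \<in> W #> (inv w \<otimes> c)" by blast
    then obtain v where v: "v \<in> W" "g = v \<otimes> (inv w \<otimes> c)"
      unfolding r_coset_def by blast
    have AG: "inv w \<otimes> c \<in> carrier G" if "c \<in> A" for c
      using that A(1) CG wG by blast
    have vn: "v \<in> carrier G" "len v \<le> real n"
      using v(1) W(3) by auto
    have "len g \<le> len v + len (inv w \<otimes> c)"
      unfolding v(2) using vn AG[OF c(1)] by (intro len_mult)
    moreover have "len (inv w \<otimes> c) \<le> R"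
      unfolding R_def using A(2) c(1) AG by (intro member_le_sum) (auto intro: len_nonneg)
    ultimately show ?thesis
      using vn by simp
  qed
  then show ?thesis by blast
qed

lemma hyperbolic_topological_groupI:
  assumes "tdlc_group G T" "hyperbolic_group G T"
  obtains len D where "hyperbolic_topological_group G T len D"
proof -
  interpret topological_group G T
    using assms(1) by (simp add: tdlc_group_def)
  obtain K where K: "compactin T K" "generate G K = carrier G"
      "gromov_hyperbolic (carrier G) (graph_dist (cayley_graph G K))"
    using assms(2) by (auto simp: hyperbolic_group_def compact_generating_set_def)
  obtain D where D: "hyperbolic_length G (word_length G K) D"
    using hyperbolic_length_word_length[OF K(2,3)] .
  have lc: "locally_compact_space T" and H: "Hausdorff_space T"
    using assms(1) Hausdorff_if_totally_disconnected by (auto simp: tdlc_group_def)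
  note ball = compactin_word_ball[OF K(1,2)]
  have "hyperbolic_topological_group G T (word_length G K) D"
    by (intro hyperbolic_topological_group.intro topological_group_axioms D
        hyperbolic_topological_group_axioms.intro ball compact_imp_bounded[OF lc H D ball])
  then show thesis ..
qed

section \<open>Loxodromic elements and compact open subgroups\<close>

lemma (in group) conj_set_self:
  assumes V: "subgroup V G" and v: "v \<in> V"
  shows "conj_set G v V = V"
proof -
  have *: "conj_set G w V \<subseteq> V" if "w \<in> V" for w
    using that subgroup.m_closed[OF V] subgroup.m_inv_closed[OF V] by (auto simp: conj_set_def)
  have vG: "v \<in> carrier G" and VG: "V \<subseteq> carrier G"
    using v subgroup.subset[OF V] by auto
  have "conj_set G v (conj_set G (inv v) V) \<subseteq> conj_set G v V"
    using *[OF subgroup.m_inv_closed[OF V v]] by (rule conj_set_mono)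
  then show ?thesis
    using *[OF v] vG VG by (simp add: conj_set_inv)
qed

context hyperbolic_topological_group
begin

abbreviation ball :: "real \<Rightarrow> 'a set" where
  "ball R \<equiv> {g \<in> carrier G. len g \<le> R}"

lemma loxodromic_inv:
  assumes "loxodromic c"
  shows "loxodromic (inv c)"
  using assms by (auto simp: loxodromic_def nat_pow_inv len_inv)

text \<open>Pigeonhole principle: a compact ball meets only finitely many cosets of
  \<open>U\<close>.\<close>

lemma same_r_coset_in_ball:
  assumes U: "compact_open_subgroup G T U"
    and g: "\<And>m. m \<in> M \<Longrightarrow> g m \<in> ball R" and M: "infinite M \<or> card ((\<lambda>x. U #> x) ` ball R) < card M"
  shows "\<exists>m\<in>M. \<exists>n\<in>M. m \<noteq> n \<and> g n \<otimes> inv (g m) \<in> U"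
proof -
  note U' = compact_open_subgroupD[OF U]
  have fin: "finite ((\<lambda>x. U #> x) ` ball R)"
    using finite_r_cosets_compact[OF compact_ball U'(1,3)] .
  have sub: "(\<lambda>m. U #> g m) ` M \<subseteq> (\<lambda>x. U #> x) ` ball R"
    using g by auto
  have "\<not> inj_on (\<lambda>m. U #> g m) M"
    using M inj_on_finite[OF _ sub fin] card_inj_on_le[OF _ sub fin] by auto
  then obtain m n where mn: "m \<in> M" "n \<in> M" "m \<noteq> n" "U #> g m = U #> g n"
    unfolding inj_on_def by blast
  then have "g n \<otimes> inv (g m) \<in> U"
    using g r_coset_eq_iff[OF U'(1), of "g m" "g n"] by auto
  with mn show ?thesis by blast
qed

text \<open>Without loxodromic powers, some \<open>x\<close> conjugates arbitrarily many initial
  powers of \<open>g\<close> into a fixed ball. Exponents \<open>0\<close> to \<open>N\<close> give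
  one element more than there are cosets of \<open>U\<close> in that ball. Hence a positive power of
  \<open>g\<close> lies in \<open>conj_set G x U\<close>, which it then normalises.\<close>

lemma loxodromic_or_normalises:
  assumes U: "compact_open_subgroup G T U" and g: "g \<in> carrier G"
  shows "(\<exists>i>0. \<exists>V. compact_open_subgroup G T V \<and> conj_set G (g [^] (i::nat)) V = V) \<or>
    (\<exists>p>0. loxodromic (g [^] (p::nat)))"
proof (rule disjCI)
  assume "\<not> (\<exists>p>0. loxodromic (g [^] (p::nat)))"
  then obtain R where R: "\<And>k::nat. \<exists>x\<in>carrier G. \<forall>i\<le>k. len (inv x \<otimes> g [^] i \<otimes> x) \<le> R"
    using no_parabolics[OF g] by blast
  define N where "N = card ((\<lambda>x. U #> x) ` ball R)"
  obtain x where x: "x \<in> carrier G" "\<And>i::nat. i \<le> N \<Longrightarrow> len (inv x \<otimes> g [^] i \<otimes> x) \<le> R"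
    using R[of N] by blast
  have "\<exists>i\<in>{..N}. \<exists>j\<in>{..N}. i \<noteq> j \<and> (inv x \<otimes> g [^] j \<otimes> x) \<otimes> inv (inv x \<otimes> g [^] i \<otimes> x) \<in> U"
    using x g by (intro same_r_coset_in_ball[OF U, where R = R]) (auto simp: N_def)
  then obtain i j :: nat where ij: "i \<noteq> j"
    and mem: "(inv x \<otimes> g [^] j \<otimes> x) \<otimes> inv (inv x \<otimes> g [^] i \<otimes> x) \<in> U"
    by blast
  note U' = compact_open_subgroupD[OF U]
  define d where "d = inv x \<otimes> (g [^] j \<otimes> inv (g [^] i)) \<otimes> x"
  have "d \<in> U"
    using mem x g by (simp add: d_def m_assoc inv_mult_group)
  obtain n :: nat where n: "n > 0" "inv x \<otimes> g [^] n \<otimes> x \<in> U"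
  proof (cases "i < j")
    case True
    have "g [^] j = g [^] (j - i) \<otimes> g [^] i"
      using g True by (simp add: nat_pow_mult)
    then have "d = inv x \<otimes> g [^] (j - i) \<otimes> x"
      using g x by (simp add: d_def m_assoc)
    then show thesis
      using \<open>d \<in> U\<close> True that[of "j - i"] by simp
  next
    case False
    have "g [^] i = g [^] (i - j) \<otimes> g [^] j"
      using g False by (simp add: nat_pow_mult)
    then have "inv d = inv x \<otimes> g [^] (i - j) \<otimes> x"
      using g x by (simp add: d_def m_assoc inv_mult_group)
    then show thesis
      using subgroup.m_inv_closed[OF U'(1) \<open>d \<in> U\<close>] False ij that[of "i - j"] by simp
  qed
  have V: "compact_open_subgroup G T (conj_set G x U)"
    using compact_open_conj_set[OF U x(1)] .
  moreover have "g [^] n \<in> conj_set G x U"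
    using conj_set_iff[OF x(1) subgroup.subset[OF U'(1)]] n(2) g by simp
  ultimately show "\<exists>i>0. \<exists>V. compact_open_subgroup G T V \<and> conj_set G (g [^] (i::nat)) V = V"
    using n(1) conj_set_self[OF compact_open_subgroupD(1)[OF V]] by blast
qed

text \<open>The length of a conjugate of \<open>u\<close> by \<open>c [^] k\<close> is the
  displacement by \<open>u\<close> of the inverse of \<open>c [^] k\<close>. For
  \<open>j \<le> k\<close> the point \<open>inv c [^] j\<close> is nearly between
  \<open>\<one>\<close> and \<open>inv c [^] k\<close>, both moved boundedly, so
  \<open>moved_between\<close> applies.\<close>

lemma conj_pow_bounded:
  assumes c: "loxodromic c" and U: "compact_open_subgroup G T U"
    and often: "\<And>k0. \<exists>k\<ge>k0. conj_set G (c [^] (k::nat)) U \<subseteq> ball R"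
  shows "\<exists>R'. \<forall>j::nat. conj_set G (c [^] j) U \<subseteq> ball R'"
proof -
  obtain r where r: "\<And>u. u \<in> U \<Longrightarrow> len u \<le> r"
    using compact_bounded[OF compact_open_subgroupD(2)[OF U]] by blast
  have UG: "U \<subseteq> carrier G"
    using subgroup.subset[OF compact_open_subgroupD(1)[OF U]] .
  have cG: "c \<in> carrier G"
    using c by (simp add: loxodromic_def)
  let ?i = "inv c"
  have conj: "c [^] k \<otimes> u \<otimes> inv (c [^] k) = inv (?i [^] k) \<otimes> u \<otimes> ?i [^] k" for k :: nat and u
    using cG by (simp add: nat_pow_inv)
  have "conj_set G (c [^] j) U \<subseteq> ball (max r R + (len c + D) + D)" for j :: nat
  proof
    fix x assume "x \<in> conj_set G (c [^] j) U"
    then obtain u where u: "u \<in> U" "x = c [^] j \<otimes> u \<otimes> inv (c [^] j)"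
      unfolding conj_set_def by blast
    have uG: "u \<in> carrier G"
      using u UG by blast
    obtain k where k: "j \<le> k" "conj_set G (c [^] k) U \<subseteq> ball R"
      using often by blast
    have "len (c [^] k \<otimes> u \<otimes> inv (c [^] k)) \<le> R"
      using k(2) u(1) unfolding conj_set_def by blast
    then have "ldist (?i [^] k) (u \<otimes> ?i [^] k) \<le> max r R"
      using cG uG by (simp add: ldist_conj conj)
    moreover have "ldist \<one> (u \<otimes> \<one>) \<le> max r R"
      using r[OF u(1)] uG by simp
    moreover have "ldist \<one> (?i [^] j) + ldist (?i [^] j) (?i [^] k) \<le> ldist \<one> (?i [^] k) + (len c + D)"
      using loxodromic_between[OF loxodromic_inv[OF c] k(1)] cG by (simp add: len_inv)
    ultimately have "ldist (?i [^] j) (u \<otimes> ?i [^] j) \<le> max r R + (len c + D) + D"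
      using cG uG by (intro moved_between[of \<one> "?i [^] k"]) auto
    then show "x \<in> ball (max r R + (len c + D) + D)"
      using cG uG by (simp add: u(2) ldist_conj conj)
  qed
  then show ?thesis by blast
qed

text \<open>All large \<open>k\<close> are required, so that failure yields arbitrarily large
  \<open>k\<close> with a bounded conjugate, as \<open>conj_pow_bounded\<close> demands.\<close>

definition escapes :: "'a \<Rightarrow> 'a set \<Rightarrow> bool" where
  "escapes c U \<longleftrightarrow> (\<forall>R. \<exists>k0. \<forall>k\<ge>k0. \<not> conj_set G (c [^] (k::nat)) U \<subseteq> ball R)"

text \<open>If both alternatives failed, the conjugates of \<open>U\<close> by all integer powers of
  \<open>a\<close> would stay in one ball, and \<open>a\<close> would normalise a compact open
  subgroup.\<close>

lemma escapes_or_inv_escapes: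
  assumes a: "loxodromic a" and U: "compact_open_subgroup G T U"
    and no_inv: "\<And>V. compact_open_subgroup G T V \<Longrightarrow> conj_set G a V \<noteq> V"
  shows "escapes a U \<or> escapes (inv a) U"
proof (rule ccontr)
  assume "\<not> ?thesis"
  then obtain R1 R2 where often: "\<And>k0. \<exists>k\<ge>k0. conj_set G (a [^] (k::nat)) U \<subseteq> ball R1"
    "\<And>k0. \<exists>k\<ge>k0. conj_set G (inv a [^] (k::nat)) U \<subseteq> ball R2"
    unfolding escapes_def by blast
  obtain R1' where R1: "\<And>j::nat. conj_set G (a [^] j) U \<subseteq> ball R1'"
    using conj_pow_bounded[OF a U often(1)] by blast
  obtain R2' where R2: "\<And>j::nat. conj_set G (inv a [^] j) U \<subseteq> ball R2'"
    using conj_pow_bounded[OF loxodromic_inv[OF a] U often(2)] by blast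
  have aG: "a \<in> carrier G"
    using a by (simp add: loxodromic_def)
  have "conj_set G (a [^] k) U \<subseteq> ball (max R1' R2')" for k :: int
  proof (cases k)
    case (nonneg n)
    then show ?thesis
      using R1[of n] by (force simp: int_pow_int)
  next
    case (neg n)
    then have "a [^] k = inv a [^] Suc n"
      using aG int_pow_neg_int[of a "Suc n"] nat_pow_inv[of a "Suc n"] by metis
    then show ?thesis
      using R2[of "Suc n"] by force
  qed
  then show False
    using normalises_compact_open_subgroup[OF aG U compact_ball] no_inv by metis
qed

text \<open>The elements of \<open>(b a) U (b a)\<^sup>-\<^sup>1 = (a b) U (a b)\<^sup>-\<^sup>1\<close> move both \<open>b a\<close> and \<open>a\<close> by a bounded
  amount. If \<open>b a\<close> and \<open>a\<close> were in different directions, these elements would be short.\<close>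

lemma fixes_attracting_end:
  assumes a: "a \<in> carrier G" and b: "b \<in> carrier G" and U: "compact_open_subgroup G T U"
    and esc: "escapes a U"
    and comm: "\<And>k::nat. conj_set G (b \<otimes> a [^] k) U = conj_set G (a [^] k \<otimes> b) U"
  shows "\<exists>k. R \<le> gromov2 (b \<otimes> a [^] k) (a [^] (k::nat))"
proof -
  obtain r where r: "\<And>u. u \<in> U \<Longrightarrow> len u \<le> r"
    using compact_bounded[OF compact_open_subgroupD(2)[OF U]] by blast
  have UG: "U \<subseteq> carrier G"
    using subgroup.subset[OF compact_open_subgroupD(1)[OF U]] .
  \<comment> \<open>Two of the four \<open>len b\<close> are lost in conjugating by \<open>b\<close>
    to reach \<open>t\<close>, the other two in comparing the displacements of
    \<open>h \<otimes> b\<close> and \<open>h\<close>; \<open>r\<close> bounds lengths in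
    \<open>U\<close>, and \<open>D\<close> comes from \<open>moved_between\<close>.\<close>
  obtain k :: nat where "\<not> conj_set G (a [^] k) U \<subseteq> ball (R + 4 * len b + r + D)"
    using esc unfolding escapes_def by blast
  then obtain u where u: "u \<in> U" and
    big: "a [^] k \<otimes> u \<otimes> inv (a [^] k) \<notin> ball (R + 4 * len b + r + D)"
    unfolding conj_set_def by blast
  have uG: "u \<in> carrier G"
    using u UG by blast
  define h where "h = a [^] k"
  have hG: "h \<in> carrier G"
    using a by (simp add: h_def)
  define t where "t = (b \<otimes> h) \<otimes> u \<otimes> inv (b \<otimes> h)"
  have tG: "t \<in> carrier G"
    using b hG uG by (simp add: t_def)
  have "h \<otimes> u \<otimes> inv h = inv b \<otimes> t \<otimes> b"
    using b hG uG by (simp add: t_def m_assoc inv_mult_group)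
  then have "R + 4 * len b + r + D < len (inv b \<otimes> t \<otimes> b)"
    using big b tG by (simp add: h_def not_le)
  then have long: "R + 2 * len b + r + D < len t"
    using len_conj_le[OF b tG] by simp
  have "t \<in> conj_set G (h \<otimes> b) U"
    unfolding h_def comm[of k, symmetric] using u by (auto simp: conj_set_def t_def h_def)
  then have v: "inv (h \<otimes> b) \<otimes> t \<otimes> (h \<otimes> b) \<in> U"
    using conj_set_iff[of "h \<otimes> b" U t] hG b UG by simp
  have 1: "ldist (b \<otimes> h) (t \<otimes> (b \<otimes> h)) \<le> r"
  proof -
    have "t \<otimes> (b \<otimes> h) = (b \<otimes> h) \<otimes> u"
      unfolding t_def using b hG uG by (simp add: m_assoc inv_mult_group)
    then show ?thesis
      using r[OF u] b hG uG by (simp add: ldist_mult_right)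
  qed
  have "ldist (h \<otimes> b) (t \<otimes> (h \<otimes> b)) \<le> r"
    using r[OF v] b hG tG by (simp add: ldist_conj)
  moreover have "ldist h (h \<otimes> b) = len b" "ldist (t \<otimes> (h \<otimes> b)) (t \<otimes> h) = len b"
    using b hG tG by (auto simp: ldist_mult_left ldist_mult_right ldist_sym[of "h \<otimes> b" h])
  moreover have "ldist h (t \<otimes> h) \<le> ldist h (h \<otimes> b) + ldist (h \<otimes> b) (t \<otimes> h)"
    "ldist (h \<otimes> b) (t \<otimes> h) \<le> ldist (h \<otimes> b) (t \<otimes> (h \<otimes> b)) + ldist (t \<otimes> (h \<otimes> b)) (t \<otimes> h)"
    using b hG tG by (intro ldist_triangle; simp)+
  ultimately have 2: "ldist h (t \<otimes> h) \<le> r + 2 * len b"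
    by linarith
  \<comment> \<open>The excess of the path from \<open>b \<otimes> h\<close> to \<open>h\<close>
    through \<open>\<one>\<close> is exactly \<open>gromov2 (b \<otimes> h) h\<close>.\<close>
  have "ldist \<one> (t \<otimes> \<one>) \<le> (r + 2 * len b) + gromov2 (b \<otimes> h) h + D"
    using b hG tG 1 2 len_nonneg[OF b]
    by (intro moved_between[of "b \<otimes> h" h]) (auto simp: gromov2_def)
  then have "R \<le> gromov2 (b \<otimes> h) h"
    using long tG by simp
  then show ?thesis
    unfolding h_def ..
qed

text \<open>The characters stand for two coordinates of the free abelian quotient. As
  \<open>f a\<close> and \<open>f' b\<close> are nonzero, no positive power of \<open>a\<close> or
  \<open>b\<close> normalises a compact open subgroup, so both have loxodromic powers. These share
  an end, and \<open>f\<close>, which vanishes on \<open>b\<close> but not on \<open>a\<close>,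
  contradicts the resulting coincidence of cosets.\<close>

lemma no_two_independent_characters:
  fixes f f' :: "'a \<Rightarrow> int"
  assumes U: "compact_open_subgroup G T U" and H: "subgroup H G"
    and f: "\<And>x y. x \<in> H \<Longrightarrow> y \<in> H \<Longrightarrow> f (x \<otimes> y) = f x + f y"
    and f': "\<And>x y. x \<in> H \<Longrightarrow> y \<in> H \<Longrightarrow> f' (x \<otimes> y) = f' x + f' y"
    and normaliser: "\<And>g V. g \<in> H \<Longrightarrow> compact_open_subgroup G T V \<Longrightarrow> conj_set G g V = V \<Longrightarrow>
      f g = 0 \<and> f' g = 0"
    and comm: "\<And>g h. g \<in> H \<Longrightarrow> h \<in> H \<Longrightarrow> conj_set G (g \<otimes> h) U = conj_set G (h \<otimes> g) U"
    and a: "a \<in> H" "f a \<noteq> 0" and b: "b \<in> H" "f b = 0" "f' b \<noteq> 0"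
  shows False
proof -
  have HG: "H \<subseteq> carrier G"
    using H by (rule subgroup.subset)
  have pow: "g [^] (n::nat) \<in> H \<and> e (g [^] n) = int n * e g"
    if e: "\<And>x y. x \<in> H \<Longrightarrow> y \<in> H \<Longrightarrow> e (x \<otimes> y) = e x + e y" and g: "g \<in> H" for e :: "'a \<Rightarrow> int" and g n
  proof (induction n)
    case 0
    have "e \<one> = 0"
      using e[of \<one> \<one>] subgroup.one_closed[OF H] by simp
    then show ?case
      using subgroup.one_closed[OF H] by simp
  next
    case (Suc n)
    then show ?case
      using e[of "g [^] n" g] g subgroup.m_closed[OF H] by (simp add: algebra_simps)
  qed
  have inv: "inv g \<in> H \<and> e (inv g) = - e g"
    if e: "\<And>x y. x \<in> H \<Longrightarrow> y \<in> H \<Longrightarrow> e (x \<otimes> y) = e x + e y" and g: "g \<in> H" for e :: "'a \<Rightarrow> int" and g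
  proof -
    have "inv g \<in> H"
      using subgroup.m_inv_closed[OF H g] .
    moreover have "e \<one> = 0"
      using e[of \<one> \<one>] subgroup.one_closed[OF H] by simp
    ultimately show ?thesis
      using e[of g "inv g"] g HG by auto
  qed
  obtain p where p: "0 < p" "loxodromic (a [^] (p::nat))"
  proof -
    have "\<not> (\<exists>i>0. \<exists>V. compact_open_subgroup G T V \<and> conj_set G (a [^] (i::nat)) V = V)"
      using normaliser[of "a [^] _"] pow[OF f a(1)] a(2) by (metis mult_eq_0_iff of_nat_0_less_iff less_irrefl)
    then show thesis
      using loxodromic_or_normalises[OF U, of a] a HG that by blast
  qed
  obtain q where q: "0 < q" "loxodromic (b [^] (q::nat))"
  proof -
    have "\<not> (\<exists>i>0. \<exists>V. compact_open_subgroup G T V \<and> conj_set G (b [^] (i::nat)) V = V)"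
      using normaliser[of "b [^] _"] pow[OF f' b(1)] b(3) by (metis mult_eq_0_iff of_nat_0_less_iff less_irrefl)
    then show thesis
      using loxodromic_or_normalises[OF U, of b] b HG that by blast
  qed
  define a1 where "a1 = a [^] p"
  have a1: "a1 \<in> H" "f a1 \<noteq> 0" "loxodromic a1"
    using pow[OF f a(1), of p] a(2) p by (auto simp: a1_def)
  have "escapes a1 U \<or> escapes (inv a1) U"
    using normaliser[OF a1(1)] a1 by (intro escapes_or_inv_escapes[OF a1(3) U]) auto
  then obtain c where c: "c \<in> H" "f c \<noteq> 0" "loxodromic c" "escapes c U"
    using a1 inv[OF f a1(1)] loxodromic_inv[OF a1(3)] by fastforce
  define b1 where "b1 = b [^] q"
  have b1: "b1 \<in> H" "f b1 = 0" "loxodromic b1"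
    using pow[OF f b(1), of q] b(2) q by (auto simp: b1_def)
  have cG: "c \<in> carrier G" and b1G: "b1 \<in> carrier G"
    using c b1 HG by auto
  have "\<exists>k. R \<le> gromov2 (b1 [^] j \<otimes> c [^] k) (c [^] (k::nat))" for j :: nat and R
    using pow[OF f b1(1), of j] pow[OF f c(1)] cG b1G comm
    by (intro fixes_attracting_end[OF _ _ U c(4)]) auto
  then have "(\<forall>M. \<exists>j k. M < gromov2 (b1 [^] (j::nat)) (c [^] (k::nat))) \<or>
      (\<forall>M. \<exists>j k. M < gromov2 (inv b1 [^] (j::nat)) (c [^] (k::nat)))"
    by (rule loxodromic_fixed_end[OF cG b1(3)])
  \<comment> \<open>Here \<open>d\<close> is \<open>b1\<close> or its inverse, whichever points to
    the attracting end of \<open>c\<close>.\<close>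
  then obtain d where d: "d \<in> H" "f d = 0" "loxodromic d"
    and same: "\<And>M. \<exists>j k. M < gromov2 (d [^] (j::nat)) (c [^] (k::nat))"
    using b1 inv[OF f b1(1)] loxodromic_inv[OF b1(3)] by fastforce
  have dG: "d \<in> carrier G"
    using d HG by auto
  obtain C where "\<And>m::nat. \<exists>n::nat. ldist (c [^] m) (d [^] n) \<le> C"
    using loxodromic_same_end[OF c(3) d(3) same] by blast
  then obtain n where n: "\<And>m::nat. ldist (c [^] m) (d [^] (n m :: nat)) \<le> C"
    by metis
  \<comment> \<open>These elements stay in the ball of radius \<open>C\<close>, while their values
    under \<open>f\<close> are pairwise different.\<close>
  define g where "g m = inv (c [^] m) \<otimes> d [^] n m" for m :: nat
  have gH: "g m \<in> H" "f (g m) = - int m * f c" for m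
    using pow[OF f c(1), of m] pow[OF f d(1), of "n m"] inv[OF f, of "c [^] m"] f
      subgroup.m_closed[OF H] d(2) by (auto simp: g_def)
  have "\<exists>i\<in>UNIV. \<exists>j\<in>UNIV. i \<noteq> j \<and> g j \<otimes> inv (g i) \<in> U"
    using n cG dG by (intro same_r_coset_in_ball[OF U, where R = C]) (auto simp: g_def ldist_def)
  then obtain i j where ij: "i \<noteq> j" "g j \<otimes> inv (g i) \<in> U" by blast
  have "conj_set G (g j \<otimes> inv (g i)) U = U"
    using conj_set_self[OF compact_open_subgroupD(1)[OF U] ij(2)] .
  moreover have "g j \<otimes> inv (g i) \<in> H" "f (g j \<otimes> inv (g i)) = (int i - int j) * f c"
    using gH inv[OF f gH(1)] f subgroup.m_closed[OF H] by (auto simp: algebra_simps)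
  ultimately have "(int i - int j) * f c = 0"
    using normaliser[OF _ U] by metis
  then show False
    using c(2) ij(1) by simp
qed

end

section \<open>Minimizing subgroups and inner automorphisms\<close>

definition inner_automorphism :: "('a, 'b) monoid_scheme \<Rightarrow> 'a \<Rightarrow> 'a \<Rightarrow> 'a" where
  "inner_automorphism G g = (\<lambda>x\<in>carrier G. g \<otimes>\<^bsub>G\<^esub> x \<otimes>\<^bsub>G\<^esub> inv\<^bsub>G\<^esub> g)"

lemma inner_auto_eq: "inner_auto G = inner_automorphism G ` carrier G"
  by (auto simp: inner_auto_def inner_automorphism_def)

lemma inner_automorphism_image:
  "X \<subseteq> carrier G \<Longrightarrow> inner_automorphism G g ` X = conj_set G g X"
  unfolding inner_automorphism_def conj_set_def by (intro image_cong) auto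

section \<open>The group of topological automorphisms\<close>

lemma TopAutoGroup_eq: "TopAutoGroup G T = BijGroup (carrier G) \<lparr>carrier := top_auto G T\<rparr>"
  by (simp add: TopAutoGroup_def AutoGroup_def)

context topological_group
begin

lemma subgroup_top_auto: "subgroup (top_auto G T) (BijGroup (carrier G))"
proof (rule group.subgroupI[OF group_BijGroup])
  show "top_auto G T \<subseteq> carrier (BijGroup (carrier G))"
    using subgroup.subset[OF subgroup_auto] by (auto simp: top_auto_def)
  have "homeomorphic_map T T (\<lambda>x\<in>carrier G. x)"
    using homeomorphic_map_eq[OF homeomorphic_map_id[THEN iffD2, OF refl], of T "\<lambda>x\<in>carrier G. x"]
    by (simp add: topspace_carrier)
  then show "top_auto G T \<noteq> {}"
    using id_in_auto by (auto simp: top_auto_def)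
next
  fix f assume f: "f \<in> top_auto G T"
  then have fB: "f \<in> Bij (carrier G)" and fA: "f \<in> auto G"
    by (auto simp: top_auto_def auto_def)
  obtain h where h: "homeomorphic_maps T T f h"
    using f by (auto simp: top_auto_def homeomorphic_map_maps)
  \<comment> \<open>The inverse in \<open>BijGroup\<close> is this restricted function; it agrees on
    the carrier with the continuous inverse \<open>h\<close>.\<close>
  have "homeomorphic_map T T (\<lambda>x\<in>carrier G. inv_into (carrier G) f x)"
  proof (rule homeomorphic_map_eq)
    show "homeomorphic_map T T h"
      using h by (simp add: homeomorphic_maps_map)
    show "h x = (\<lambda>x\<in>carrier G. inv_into (carrier G) f x) x" if "x \<in> topspace T" for x
    proof -
      have x: "x \<in> carrier G"
        using that topspace_carrier by simp
      have "f (h x) = x" "h x \<in> carrier G"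
        using h that by (auto simp: homeomorphic_maps_def continuous_map_def topspace_carrier)
      moreover have "inj_on f (carrier G)"
        using fB by (simp add: Bij_def bij_betw_def)
      ultimately show ?thesis
        using x by (metis inv_into_f_f restrict_apply')
    qed
  qed
  then show "inv\<^bsub>BijGroup (carrier G)\<^esub> f \<in> top_auto G T"
    using subgroup.m_inv_closed[OF subgroup_auto fA] inv_BijGroup[OF fB] by (simp add: top_auto_def)
next
  fix f h assume fh: "f \<in> top_auto G T" "h \<in> top_auto G T"
  then have B: "f \<in> Bij (carrier G)" "h \<in> Bij (carrier G)" and A: "f \<in> auto G" "h \<in> auto G"
    by (auto simp: top_auto_def auto_def)
  have "homeomorphic_map T T (compose (carrier G) f h)"
  proof (rule homeomorphic_map_eq)
    show "homeomorphic_map T T (f \<circ> h)"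
      using fh by (intro homeomorphic_map_compose) (auto simp: top_auto_def)
  qed (simp add: topspace_carrier compose_def)
  then show "f \<otimes>\<^bsub>BijGroup (carrier G)\<^esub> h \<in> top_auto G T"
    using subgroup.m_closed[OF subgroup_auto A] B by (simp add: top_auto_def BijGroup_def)
qed

lemma group_TopAutoGroup: "group (TopAutoGroup G T)"
  unfolding TopAutoGroup_eq by (rule subgroup.subgroup_is_group[OF subgroup_top_auto group_BijGroup])

lemma inner_automorphism_in_top_auto:
  assumes g: "g \<in> carrier G"
  shows "inner_automorphism G g \<in> top_auto G T"
proof -
  let ?i = "inner_automorphism G"
  have "?i g \<in> hom G G"
    using g by (auto simp: hom_def inner_automorphism_def m_assoc)
  have maps: "homeomorphic_maps T T (?i g) (?i (inv g))"
  proof -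
    have cont: "continuous_map T T (?i h)" if "h \<in> carrier G" for h
      using continuous_map_eq[OF continuous_map_conj[OF that inv_closed[OF that]], of "?i h"] that
      by (simp add: inner_automorphism_def topspace_carrier)
    show ?thesis
      unfolding homeomorphic_maps_def using cont[OF g] cont[OF inv_closed[OF g]] g
      by (auto simp: topspace_carrier inner_automorphism_def m_assoc)
  qed
  then have hom: "homeomorphic_map T T (?i g)"
    using homeomorphic_map_maps by blast
  have "bij_betw (?i g) (carrier G) (carrier G)"
    using homeomorphic_imp_injective_map[OF hom] homeomorphic_imp_surjective_map[OF hom]
    by (simp add: bij_betw_def topspace_carrier)
  then have "?i g \<in> Bij (carrier G)"
    by (simp add: Bij_def inner_automorphism_def)
  then show ?thesis
    using hom \<open>?i g \<in> hom G G\<close> by (simp add: top_auto_def auto_def)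
qed

lemma inner_automorphism_mult:
  assumes "g \<in> carrier G" "h \<in> carrier G"
  shows "inner_automorphism G g \<otimes>\<^bsub>TopAutoGroup G T\<^esub> inner_automorphism G h
    = inner_automorphism G (g \<otimes> h)"
proof -
  have "inner_automorphism G x \<in> Bij (carrier G)" if "x \<in> carrier G" for x
    using inner_automorphism_in_top_auto[OF that] by (simp add: top_auto_def auto_def)
  then have "inner_automorphism G g \<otimes>\<^bsub>TopAutoGroup G T\<^esub> inner_automorphism G h
      = compose (carrier G) (inner_automorphism G g) (inner_automorphism G h)"
    using assms by (simp add: TopAutoGroup_eq BijGroup_def)
  also have "\<dots> = inner_automorphism G (g \<otimes> h)"
    using assms by (auto simp: compose_def inner_automorphism_def m_assoc inv_mult_group)
  finally show ?thesis .
qed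

lemma inner_automorphism_one: "inner_automorphism G \<one> = \<one>\<^bsub>TopAutoGroup G T\<^esub>"
  by (auto simp: TopAutoGroup_eq BijGroup_def inner_automorphism_def)

lemma inner_automorphism_inv:
  assumes g: "g \<in> carrier G"
  shows "inv\<^bsub>TopAutoGroup G T\<^esub> (inner_automorphism G g) = inner_automorphism G (inv g)"
proof (rule group.inv_equality[OF group_TopAutoGroup])
  show "inner_automorphism G (inv g) \<otimes>\<^bsub>TopAutoGroup G T\<^esub> inner_automorphism G g
      = \<one>\<^bsub>TopAutoGroup G T\<^esub>"
    using g by (simp add: inner_automorphism_mult inner_automorphism_one)
qed (use g inner_automorphism_in_top_auto in \<open>simp_all add: TopAutoGroup_eq\<close>)

lemma displacement_index_conj:
  assumes "X \<subseteq> carrier G"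
  shows "displacement_index G (inner_automorphism G g) X
    = card ((\<lambda>x. (conj_set G g X \<inter> X) #> x) ` conj_set G g X)"
  unfolding displacement_index_def subgroup_index_def RCOSETS_def
    inner_automorphism_image[OF assms] UNION_singleton_eq_range
  by (simp only: r_coset_def monoid.simps partial_object.simps)
    (rule arg_cong[of _ _ card], simp)

text \<open>If \<open>g\<close> normalises some compact open subgroup, then \<open>g\<close> and its inverse have scale 1, which
  means that \<open>g\<close> normalises every minimizing subgroup.\<close>

lemma minimizing_imp_normalised:
  assumes min: "minimizing_for_all G T A U" and g: "g \<in> carrier G"
    and A: "inner_automorphism G g \<in> A" "inner_automorphism G (inv g) \<in> A"
    and V: "compact_open_subgroup G T V" "conj_set G g V = V"
  shows "conj_set G g U = U"
proof -
  have U: "compact_open_subgroup G T U"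
    using min by (simp add: minimizing_for_all_def)
  note U' = compact_open_subgroupD[OF U]
  have UG: "U \<subseteq> carrier G"
    using subgroup.subset[OF U'(1)] .
  have VG: "V \<subseteq> carrier G"
    using subgroup.subset[OF compact_open_subgroupD(1)[OF V(1)]] .
  have sub: "conj_set G h U \<subseteq> U"
    if h: "h \<in> carrier G" "inner_automorphism G h \<in> A" "conj_set G h V = V" for h
  proof
    note C = compact_open_conj_set[OF U h(1)]
    note C' = compact_open_subgroupD[OF C]
    define W where "W = conj_set G h U \<inter> U"
    have W: "subgroup W G" "openin T W"
      unfolding W_def using C' U' by (auto intro: subgroups_Inter_pair)
    let ?cs = "(\<lambda>x. W #> x) ` conj_set G h U"
    have "(\<lambda>x. V #> x) ` V = {V}"
      using VG subgroup.one_closed[OF compact_open_subgroupD(1)[OF V(1)]]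
        coset_join2[OF _ compact_open_subgroupD(1)[OF V(1)]] by auto
    then have "displacement_index G (inner_automorphism G h) V = 1"
      using h(3) VG by (simp add: displacement_index_conj)
    moreover have "scale G T (inner_automorphism G h) \<le> displacement_index G (inner_automorphism G h) V"
      unfolding scale_def using V(1) by (intro cINF_lower) auto
    moreover have "displacement_index G (inner_automorphism G h) U = scale G T (inner_automorphism G h)"
      using min h(2) by (auto simp: minimizing_for_all_def minimizing_def)
    ultimately have le: "card ?cs \<le> 1"
      using UG by (simp add: displacement_index_conj W_def)
    fix x assume x: "x \<in> conj_set G h U"
    have one: "\<one> \<in> conj_set G h U"
      using subgroup.one_closed[OF C'(1)] .
    have xG: "x \<in> carrier G"
      using subgroup.mem_carrier[OF C'(1) x] .
    \<comment> \<open>Needed because \<open>card\<close> is \<open>0\<close> on infinite sets; only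
      now does \<open>le\<close> mean that there is a single coset.\<close>
    have "finite ?cs"
      using finite_r_cosets_compact[OF C'(2) W] .
    then have "\<forall>X\<in>?cs. \<forall>Y\<in>?cs. X = Y"
      using le by (simp only: card_le_Suc0_iff_eq One_nat_def)
    from this[rule_format, OF imageI[OF x] imageI[OF one]] have "W #> x = W #> \<one>" .
    then have "x \<in> W"
      using r_coset_eq_iff[OF W(1) one_closed xG] xG by simp
    then show "x \<in> U"
      by (simp add: W_def)
  qed
  have "conj_set G (inv g) V = V"
    using conj_set_inv(1)[OF g VG] V(2) by simp
  then have "conj_set G (inv g) U \<subseteq> U"
    using sub A(2) g by simp
  then have "conj_set G g (conj_set G (inv g) U) \<subseteq> conj_set G g U"
    by (rule conj_set_mono)
  then have "U \<subseteq> conj_set G g U"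
    using conj_set_inv(2)[OF g UG] by simp
  then show ?thesis
    using sub[OF g A(1) V(2)] by blast
qed

text \<open>Pull the quotient back to the group \<open>L\<close> of elements that induce
  automorphisms in \<open>H\<close>. The composite into the free abelian group has the elements
  normalising \<open>U\<close> as kernel; its coordinates at \<open>p\<close> and \<open>q\<close>
  are the characters, and \<open>a\<close>, \<open>b\<close> are preimages of these basis
  elements.\<close>

lemma rank_two_characters:
  assumes H: "subgroup H (TopAutoGroup G T)" "H \<subseteq> inner_auto G"
    and min: "minimizing_for_all G T H U"
    and iso: "\<phi> \<in> iso ((TopAutoGroup G T)\<lparr>carrier := H\<rparr> Mod set_stabilizer H U) (free_Abelian_group B)"
    and pq: "p \<in> B" "q \<in> B" "p \<noteq> q"
  obtains L and f f' :: "'a \<Rightarrow> int" and a b where "subgroup L G"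
    "\<And>x y. x \<in> L \<Longrightarrow> y \<in> L \<Longrightarrow> f (x \<otimes> y) = f x + f y"
    "\<And>x y. x \<in> L \<Longrightarrow> y \<in> L \<Longrightarrow> f' (x \<otimes> y) = f' x + f' y"
    "\<And>g V. g \<in> L \<Longrightarrow> compact_open_subgroup G T V \<Longrightarrow> conj_set G g V = V \<Longrightarrow> f g = 0 \<and> f' g = 0"
    "\<And>g h. g \<in> L \<Longrightarrow> h \<in> L \<Longrightarrow> conj_set G (g \<otimes> h) U = conj_set G (h \<otimes> g) U"
    "a \<in> L" "f a \<noteq> 0" "b \<in> L" "f b = 0" "f' b \<noteq> 0"
proof -
  let ?A = "TopAutoGroup G T"
  let ?i = "inner_automorphism G"
  define K where "K = ?A\<lparr>carrier := H\<rparr>"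
  define S where "S = set_stabilizer H U"
  define L where "L = {g \<in> carrier G. ?i g \<in> H}"
  have U: "compact_open_subgroup G T U"
    using min by (simp add: minimizing_for_all_def)
  have UG: "U \<subseteq> carrier G"
    using subgroup.subset[OF compact_open_subgroupD(1)[OF U]] .
  have K: "group K"
    unfolding K_def by (rule subgroup.subgroup_is_group[OF H(1) group_TopAutoGroup])
  have K_simps: "carrier K = H" "\<And>x y. x \<otimes>\<^bsub>K\<^esub> y = x \<otimes>\<^bsub>?A\<^esub> y" "\<one>\<^bsub>K\<^esub> = \<one>\<^bsub>?A\<^esub>"
    by (simp_all add: K_def)
  have K_inv: "inv\<^bsub>K\<^esub> x = inv\<^bsub>?A\<^esub> x" if "x \<in> H" for x
    unfolding K_def using group.m_inv_consistent[OF group_TopAutoGroup H(1) that] .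
  have LG: "L \<subseteq> carrier G"
    by (auto simp: L_def)
  have H_L: "\<exists>g\<in>L. x = ?i g" if "x \<in> H" for x
    using that H(2) unfolding inner_auto_eq L_def by blast
  have L: "subgroup L G"
  proof (rule subgroupI[OF LG])
    have "?i \<one> \<in> H"
      using subgroup.one_closed[OF H(1)] by (simp add: inner_automorphism_one)
    then show "L \<noteq> {}"
      by (auto simp: L_def)
    show "inv g \<in> L" if "g \<in> L" for g
      using that subgroup.m_inv_closed[OF H(1), of "?i g"] by (auto simp: L_def inner_automorphism_inv)
    show "g \<otimes> h \<in> L" if "g \<in> L" "h \<in> L" for g h
      using that subgroup.m_closed[OF H(1), of "?i g" "?i h"] by (auto simp: L_def inner_automorphism_mult)
  qed
  have S_iff: "?i g \<in> S \<longleftrightarrow> conj_set G g U = U" if "g \<in> L" for g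
    using that UG by (simp add: S_def set_stabilizer_def L_def inner_automorphism_image)
  have fixU: "conj_set G g U = U"
    if "g \<in> L" "compact_open_subgroup G T V" "conj_set G g V = V" for g V
    using that subgroup.m_inv_closed[OF L] by (intro minimizing_imp_normalised[OF min]) (auto simp: L_def)
  have inL: "g \<in> carrier G" "?i g \<in> H" if "g \<in> L" for g
    using that by (auto simp: L_def)
  have SH: "S \<subseteq> H"
    by (auto simp: S_def set_stabilizer_def)
  have "subgroup S K"
  proof (rule group.subgroupI[OF K])
    show "S \<subseteq> carrier K"
      using SH by (simp add: K_simps)
    show "S \<noteq> {}"
      using S_iff[OF subgroup.one_closed[OF L]] conj_set_one[OF UG] by auto
    show "inv\<^bsub>K\<^esub> x \<in> S" if x: "x \<in> S" for x
    proof -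
      obtain g where g: "g \<in> L" "x = ?i g"
        using x SH H_L by blast
      then have "conj_set G (inv g) U = U"
        using S_iff[OF g(1)] x conj_set_inv(1)[OF inL(1)[OF g(1)] UG] by simp
      then show ?thesis
        using g inL[OF g(1)] S_iff[OF subgroup.m_inv_closed[OF L g(1)]]
        by (simp add: K_inv inner_automorphism_inv)
    qed
    show "x \<otimes>\<^bsub>K\<^esub> y \<in> S" if xy: "x \<in> S" "y \<in> S" for x y
    proof -
      obtain g h where gh: "g \<in> L" "x = ?i g" "h \<in> L" "y = ?i h"
        using xy SH H_L by blast
      then have "conj_set G (g \<otimes> h) U = U"
        using S_iff[OF gh(1)] S_iff[OF gh(3)] xy inL UG by (simp add: conj_set_mult)
      then show ?thesis
        using gh inL S_iff[OF subgroup.m_closed[OF L gh(1,3)]]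
        by (simp add: K_simps inner_automorphism_mult)
    qed
  qed
  then have normal: "S \<lhd> K"
  proof (rule group.normal_invI[OF K])
    fix x s assume x: "x \<in> carrier K" and s: "s \<in> S"
    obtain g h where g: "g \<in> L" "x = ?i g" and h: "h \<in> L" "s = ?i h"
      using x s SH H_L unfolding K_simps by blast
    have hU: "conj_set G h U = U"
      using s S_iff[OF h(1)] h(2) by simp
    have G: "g \<in> carrier G" "h \<in> carrier G"
      using inL g h by auto
    have gL: "g \<otimes> h \<otimes> inv g \<in> L"
      using subgroup.m_closed[OF L] subgroup.m_inv_closed[OF L] g h by blast
    \<comment> \<open>The conjugated element normalises the conjugate of \<open>U\<close>, a compact
      open subgroup; minimality of \<open>U\<close> then makes it normalise \<open>U\<close> itself,
      so \<open>S\<close> is normal.\<close>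
    have "conj_set G (g \<otimes> h \<otimes> inv g) (conj_set G g U) = conj_set G g U"
      using G UG hU conj_set_subset[OF G(1) UG]
      by (simp add: conj_set_mult conj_set_inv conj_set_subset)
    then have "conj_set G (g \<otimes> h \<otimes> inv g) U = U"
      using fixU[OF gL compact_open_conj_set[OF U G(1)]] by simp
    then show "x \<otimes>\<^bsub>K\<^esub> s \<otimes>\<^bsub>K\<^esub> inv\<^bsub>K\<^esub> x \<in> S"
      using S_iff[OF gL] g h G inL(2)[OF g(1)]
      by (simp add: K_simps K_inv inner_automorphism_inv inner_automorphism_mult)
  qed
  interpret S: normal S K by (rule normal)
  have hom: "(\<lambda>x. S #>\<^bsub>K\<^esub> x) \<in> hom K (K Mod S)"
    using S.r_coset_hom_Mod .
  have \<phi>: "\<phi> \<in> hom (K Mod S) (free_Abelian_group B)" "bij_betw \<phi> (carrier (K Mod S)) (carrier (free_Abelian_group B))"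
    using iso by (auto simp: iso_def K_def S_def)
  define \<psi> where "\<psi> g = \<phi> (S #>\<^bsub>K\<^esub> ?i g)" for g
  have Mod: "S #>\<^bsub>K\<^esub> ?i g \<in> carrier (K Mod S)" if "g \<in> L" for g
    using hom inL(2)[OF that] by (auto simp: hom_def K_simps)
  have \<psi>_mult: "\<psi> (g \<otimes> h) = \<psi> g + \<psi> h" if gh: "g \<in> L" "h \<in> L" for g h
  proof -
    have "S #>\<^bsub>K\<^esub> ?i (g \<otimes> h) = (S #>\<^bsub>K\<^esub> ?i g) \<otimes>\<^bsub>K Mod S\<^esub> (S #>\<^bsub>K\<^esub> ?i h)"
      using hom_mult[OF hom, of "?i g" "?i h"] gh inL by (simp add: K_simps inner_automorphism_mult)
    then show ?thesis
      using hom_mult[OF \<phi>(1) Mod[OF gh(1)] Mod[OF gh(2)]] by (simp add: \<psi>_def)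
  qed
  have \<psi>_one: "\<psi> \<one> = 0"
    using \<psi>_mult[of \<one> \<one>] subgroup.one_closed[OF L] by simp
  have \<psi>_inv: "\<psi> (inv g) = - \<psi> g" if "g \<in> L" for g
    using \<psi>_mult[of "inv g" g] subgroup.m_inv_closed[OF L that] that inL(1)[OF that] \<psi>_one
    by (simp add: eq_neg_iff_add_eq_0)
  have S_one: "S #>\<^bsub>K\<^esub> ?i \<one> = S"
    using group.coset_mult_one[OF K] SH by (simp add: inner_automorphism_one K_simps(1) flip: K_simps(3))
  have \<psi>_zero: "\<psi> g = 0 \<longleftrightarrow> conj_set G g U = U" if g: "g \<in> L" for g
  proof -
    have "\<psi> g = 0 \<longleftrightarrow> \<phi> (S #>\<^bsub>K\<^esub> ?i g) = \<phi> (S #>\<^bsub>K\<^esub> ?i \<one>)"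
      using \<psi>_one by (simp add: \<psi>_def)
    also have "\<dots> \<longleftrightarrow> S #>\<^bsub>K\<^esub> ?i g = S"
      using \<phi>(2) Mod[OF g] Mod[OF subgroup.one_closed[OF L]] S_one
      by (metis bij_betw_def inj_on_def)
    also have "\<dots> \<longleftrightarrow> ?i g \<in> S"
      using group.coset_join1[OF K] group.coset_join2[OF K] S.subgroup_axioms inL(2)[OF g]
      by (metis K_simps(1))
    finally show ?thesis
      using S_iff[OF g] by simp
  qed
  have surj: "\<exists>g\<in>L. \<psi> g = frag_of c" if "c \<in> B" for c
  proof -
    have "frag_of c \<in> \<phi> ` carrier (K Mod S)"
      using \<phi>(2) that by (simp add: bij_betw_def)
    then obtain X where X: "X \<in> carrier (K Mod S)" "frag_of c = \<phi> X" by blast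
    then obtain x where "x \<in> H" "X = S #>\<^bsub>K\<^esub> x"
      by (auto simp: FactGroup_def RCOSETS_def K_simps)
    then show ?thesis
      using H_L X(2) unfolding \<psi>_def by metis
  qed
  obtain a b where ab: "a \<in> L" "\<psi> a = frag_of p" "b \<in> L" "\<psi> b = frag_of q"
    using surj pq by blast
  show thesis
  proof (rule that[OF L])
    let ?f = "\<lambda>c g. Poly_Mapping.lookup (\<psi> g) c"
    show "?f c (x \<otimes> y) = ?f c x + ?f c y" if "x \<in> L" "y \<in> L" for c x y
      using that by (simp add: \<psi>_mult lookup_add)
    show "?f c (x \<otimes> y) = ?f c x + ?f c y" if "x \<in> L" "y \<in> L" for c x y
      using that by (simp add: \<psi>_mult lookup_add)
    show "?f p g = 0 \<and> ?f q g = 0"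
      if "g \<in> L" "compact_open_subgroup G T V" "conj_set G g V = V" for g V
      using fixU[OF that] \<psi>_zero[OF that(1)] by simp
    show "conj_set G (g \<otimes> h) U = conj_set G (h \<otimes> g) U" if gh: "g \<in> L" "h \<in> L" for g h
    proof -
      have m: "g \<otimes> h \<in> L" "h \<otimes> g \<in> L" "inv (h \<otimes> g) \<in> L"
        using gh subgroup.m_closed[OF L] subgroup.m_inv_closed[OF L] by auto
      have G: "g \<otimes> h \<in> carrier G" "h \<otimes> g \<in> carrier G"
        using m LG by auto
      \<comment> \<open>The target is abelian, so this commutator lies in the kernel and normalises
        \<open>U\<close>.\<close>
      have "\<psi> (inv (h \<otimes> g) \<otimes> (g \<otimes> h)) = 0"
        using m gh by (simp add: \<psi>_mult \<psi>_inv)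
      then have "conj_set G (inv (h \<otimes> g) \<otimes> (g \<otimes> h)) U = U"
        using \<psi>_zero subgroup.m_closed[OF L m(3,1)] by blast
      then have "conj_set G (h \<otimes> g) (conj_set G (inv (h \<otimes> g)) (conj_set G (g \<otimes> h) U)) = conj_set G (h \<otimes> g) U"
        using G UG conj_set_mult[of "inv (h \<otimes> g)" "g \<otimes> h" U] by simp
      then show ?thesis
        using conj_set_inv(2)[OF G(2)] conj_set_subset[OF G(1) UG] by simp
    qed
    show "?f p a \<noteq> 0" "?f p b = 0" "?f q b \<noteq> 0"
      using ab pq by (auto simp: lookup_single)
  qed (use ab in auto)
qed

end

theorem theorem1:
  fixes G :: "('a, 'b) monoid_scheme" and T :: "'a topology"
  assumes "tdlc_group G T"
    and "hyperbolic_group G T"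
  shows "flat_rank G T \<le> 1"
proof -
  obtain len D where "hyperbolic_topological_group G T len D"
    using hyperbolic_topological_groupI[OF assms] .
  then interpret hyperbolic_topological_group G T len D .
  have "r \<le> 1" if H: "subgroup H ((TopAutoGroup G T)\<lparr>carrier := inner_auto G\<rparr>)"
    and r: "flat_group_has_rank G T H r" for H r
  proof (rule ccontr)
    assume "\<not> r \<le> 1"
    obtain U where HA: "subgroup H (TopAutoGroup G T)" and U: "minimizing_for_all G T H U"
      and free: "free_abelian_of_rank ((TopAutoGroup G T)\<lparr>carrier := H\<rparr> Mod set_stabilizer H U) r"
      using r by (auto simp: flat_group_has_rank_def flat_def)
    obtain B :: "('a \<Rightarrow> 'a) set set" where rB: "r = (if finite B then enat (card B) else \<infinity>)"
      and "iso ((TopAutoGroup G T)\<lparr>carrier := H\<rparr> Mod set_stabilizer H U) (free_Abelian_group B) \<noteq> {}"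
      using free unfolding free_abelian_of_rank_def is_iso_def by blast
    then obtain \<phi> where iso:
      "\<phi> \<in> iso ((TopAutoGroup G T)\<lparr>carrier := H\<rparr> Mod set_stabilizer H U) (free_Abelian_group B)"
      by blast
    have "\<not> (finite B \<and> card B \<le> Suc 0)"
      using \<open>\<not> r \<le> 1\<close> by (auto simp: rB one_enat_def)
    \<comment> \<open>This treats finite \<open>B\<close> and the case of rank \<infinity>
      together.\<close>
    have "\<exists>p\<in>B. \<exists>q\<in>B. p \<noteq> q"
    proof (rule ccontr)
      assume "\<not> ?thesis"
      then have eq: "\<forall>p\<in>B. \<forall>q\<in>B. p = q"
        by blast
      then have "finite B"
        by (metis finite.emptyI finite_insert finite_subset insertI1 subsetI ex_in_conv)
      then show False
        using eq card_le_Suc0_iff_eq \<open>\<not> (finite B \<and> card B \<le> Suc 0)\<close> by blast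
    qed
    then obtain p q where pq: "p \<in> B" "q \<in> B" "p \<noteq> q"
      by blast
    have "H \<subseteq> inner_auto G"
      using subgroup.subset[OF H] by simp
    then show False
    proof (rule rank_two_characters[OF HA _ U iso pq])
      fix L and f f' :: "'a \<Rightarrow> int" and a b
      assume L: "subgroup L G"
        "\<And>x y. x \<in> L \<Longrightarrow> y \<in> L \<Longrightarrow> f (x \<otimes>\<^bsub>G\<^esub> y) = f x + f y"
        "\<And>x y. x \<in> L \<Longrightarrow> y \<in> L \<Longrightarrow> f' (x \<otimes>\<^bsub>G\<^esub> y) = f' x + f' y"
        "\<And>g V. g \<in> L \<Longrightarrow> compact_open_subgroup G T V \<Longrightarrow> conj_set G g V = V \<Longrightarrow> f g = 0 \<and> f' g = 0"
        "\<And>g h. g \<in> L \<Longrightarrow> h \<in> L \<Longrightarrow> conj_set G (g \<otimes>\<^bsub>G\<^esub> h) U = conj_set G (h \<otimes>\<^bsub>G\<^esub> g) U"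
        "a \<in> L" "f a \<noteq> 0" "b \<in> L" "f b = 0" "f' b \<noteq> 0"
      have "compact_open_subgroup G T U"
        using U by (simp add: minimizing_for_all_def)
      from no_two_independent_characters[OF this L] show False .
    qed
  qed
  then show ?thesis
    unfolding flat_rank_def flat_rank_auto_def by (intro Sup_least) auto
qed

end
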